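(* Let $H\in\mathbb{R}^{N\times N}$ be a real matrix and let $S_h\in\mathbb{C}^{N\times N}$ be a family of complex matrices depending smoothly on $h\in\mathbb{R}$ such that (i) $S_h$ is reversible: $S_h$ is invertible and $\overline{S}_h=S_h^{-1}$; (ii) $S_h$ is consistent with $\exp(ihH)$, i.e. $S_h = e^{ihH}+ i h^{p+1}R+\mathcal{O}(h^{p+2})$ as $h\to 0$, where $p\ge 1$ is the order of consistency and $R$ is a real matrix; (iii) $H$ is diagonalizable and its eigenvalues are real; (iv) for all $\omega\in\sigma(H)$, the eigenvalues of $\Pi_\omega R_{|E_\omega(H)}$ are real and simple. Then there exist a family $D_h$ of real diagonal matrices depending smoothly on $h$ and a family $P_h$ of real invertible matrices depending smoothly on $h$ such that both $P_0^{-1}BP_0$ and $P_0^{-1}HP_0$ are diagonal, where $B:=\sum_{\omega\in\sigma(H)}\Pi_\omega R\,\Pi_\omega$, and, provided that $|h|$ is small enough, $$S_h = P_h\, e^{ihD_h}\, P_h^{-1}.$$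
   Context: $\overline{S}_h$ denotes the entrywise complex conjugate (no transpose) of $S_h$; $p$ is an integer. $\sigma(H)$ is the set of eigenvalues of $H$, $E_\omega(H):=\mathrm{Ker}(H-\omega I_N)$, and $\Pi_\omega$ is the spectral projector of $H$ onto $E_\omega(H)$ (the projector onto $E_\omega(H)$ along the sum of the other eigenspaces of $H$). $\Pi_\omega R_{|E_\omega(H)}$ is the linear endomorphism $v\mapsto \Pi_\omega R v$ of $E_\omega(H)$. *)

theory Defs
  imports
    "Jordan_Normal_Form.Char_Poly"
    "HOL-Library.Landau_Symbols"
    "HOL-Analysis.Analysis"
begin

no_notation vec_index (infixl "$" 100)

text \<open>
  Square matrices are those of HOL-Analysis (\<open>'a^'n^'n\<close>, product \<open>**\<close>). Of
  Jordan-Normal-Form only the characteristic polynomial is used, for the endomorphism of an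
  eigenspace, whose dimension is not a type. A few names occurring in both libraries are
  therefore written qualified.
\<close>

definition smooth :: "(real \<Rightarrow> 'a::real_normed_vector) \<Rightarrow> bool" where
  "smooth f \<longleftrightarrow> (\<exists>F :: nat \<Rightarrow> real \<Rightarrow> 'a. F 0 = f \<and>
     (\<forall>k x. (F k has_vector_derivative F (Suc k) x) (at x)))"

abbreviation cmat :: "real^'n^'m \<Rightarrow> complex^'n^'m" where
  "cmat \<equiv> map_matrix complex_of_real"

definition cscale :: "complex \<Rightarrow> complex^'n^'m \<Rightarrow> complex^'n^'m" where
  "cscale c = map_matrix ((*) c)"

text \<open>The multiplication and hence the power and \<open>exp\<close> of the type class instances of
  \<open>vec\<close> are componentwise, so the matrix exponential is written as a power series in \<open>**\<close>.\<close>

definition mexp :: "complex^'n^'n \<Rightarrow> complex^'n^'n" where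
  "mexp A = (\<Sum>k. (1 / fact k) *\<^sub>R ((\<lambda>B. A ** B) ^^ k) (Finite_Cartesian_Product.mat 1))"

definition diagonal :: "'a::zero^'n^'n \<Rightarrow> bool" where
  "diagonal A \<longleftrightarrow> (\<forall>i j. i \<noteq> j \<longrightarrow> A $ i $ j = 0)"

definition diagonalizable :: "'a::field^'n^'n \<Rightarrow> bool" where
  "diagonalizable A \<longleftrightarrow> (\<exists>Q :: 'a^'n^'n. invertible Q \<and> diagonal (matrix_inv Q ** A ** Q))"

definition eigenspace :: "'a::field^'n^'n \<Rightarrow> 'a \<Rightarrow> ('a^'n) set" where
  "eigenspace A \<omega> = {v. (A - Finite_Cartesian_Product.mat \<omega>) *v v = 0}"

definition spectrum :: "'a::field^'n^'n \<Rightarrow> 'a set" where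
  "spectrum A = {\<omega>. \<exists>v. v \<noteq> 0 \<and> A *v v = \<omega> *s v}"

text \<open>The idempotent matrix with range \<open>U\<close> and kernel \<open>W\<close>; it is uniquely determined when
  \<open>U\<close> and \<open>W\<close> are complementary subspaces.\<close>

definition projector_along :: "('a::field^'n) set \<Rightarrow> ('a^'n) set \<Rightarrow> 'a^'n^'n" where
  "projector_along U W =
     (THE Q. Q ** Q = Q \<and> range ((*v) Q) = U \<and> {v. Q *v v = 0} = W)"

definition spectral_projector :: "'a::field^'n^'n \<Rightarrow> 'a \<Rightarrow> 'a^'n^'n" where
  "spectral_projector A \<omega> = projector_along (eigenspace A \<omega>)
     (vec.span (\<Union>\<omega>'\<in>spectrum A - {\<omega>}. eigenspace A \<omega>'))"

text \<open>In what follows \<open>f\<close> maps the subspace \<open>V\<close> linearly into itself. The characteristic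
  polynomial of the restriction of \<open>f\<close> to \<open>V\<close> does not depend on the basis that is chosen.\<close>

definition basis_list :: "('a::field^'n) set \<Rightarrow> ('a^'n) list \<Rightarrow> bool" where
  "basis_list V bs \<longleftrightarrow>
     distinct bs \<and> vec.independent (set bs) \<and> vec.span (set bs) = V"

definition endo_matrix :: "('a::field^'n) list \<Rightarrow> ('a^'n \<Rightarrow> 'a^'n) \<Rightarrow> 'a Matrix.mat" where
  "endo_matrix bs f = Matrix.mat (length bs) (length bs)
     (\<lambda>(i, j). vec.representation (set bs) (f (bs ! j)) (bs ! i))"

definition endo_char_poly :: "('a::field^'n) set \<Rightarrow> ('a^'n \<Rightarrow> 'a^'n) \<Rightarrow> 'a poly" where
  "endo_char_poly V f = char_poly (endo_matrix (SOME bs. basis_list V bs) f)"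

definition endo_eigenvalue :: "('a::field^'n) set \<Rightarrow> ('a^'n \<Rightarrow> 'a^'n) \<Rightarrow> 'a \<Rightarrow> bool" where
  "endo_eigenvalue V f \<mu> \<longleftrightarrow> (\<exists>v\<in>V. v \<noteq> 0 \<and> f v = \<mu> *s v)"

definition endo_simple_eigenvalue :: "('a::field^'n) set \<Rightarrow> ('a^'n \<Rightarrow> 'a^'n) \<Rightarrow> 'a \<Rightarrow> bool" where
  "endo_simple_eigenvalue V f \<mu> \<longleftrightarrow>
     endo_eigenvalue V f \<mu> \<and> Polynomial.order \<mu> (endo_char_poly V f) = 1"

end

theory Submission
  imports Defs "HOL-Real_Asymp.Real_Asymp"
begin

text \<open>
  Since \<open>S\<close> times its entrywise conjugate is the identity, the real and imaginary parts \<open>X\<close>, \<open>Y\<close>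
  of \<open>S\<close> commute and satisfy \<open>X\<^sup>2 + Y\<^sup>2 = 1\<close>. In a real basis of eigenvectors of \<open>H\<close> that
  also diagonalizes every \<open>\<Pi>\<^sub>\<omega> R\<close> on its eigenspace, consistency and division by powers of \<open>h\<close> give
  \<open>Y = sin (h H) + h ^ (p + 1) N\<close> with \<open>N\<close> smooth and \<open>N(0) = R\<close>. The eigenpair of \<open>Y / h\<close> that
  starts at \<open>(\<omega>, \<mu>)\<close> solves a linear system whose determinant, after dividing the rows that belong
  to \<open>\<omega>\<close> by \<open>h ^ p\<close>, has a simple root at \<open>h = 0\<close>; so it depends smoothly on \<open>h\<close>, with the cofactors as
  eigenvector. For small \<open>h \<noteq> 0\<close> the eigenvalues \<open>s\<close> of \<open>Y\<close> are distinct, hence the commuting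
  matrix \<open>X\<close> is diagonal in the same basis, with eigenvalues \<open>sqrt (1 - s\<^sup>2)\<close>. No matrix logarithm is
  needed: \<open>D = arcsin s / h\<close>. A smooth cutoff of the parameter makes everything global.
\<close>

section \<open>Smooth real functions\<close>

text \<open>All eigenvalues of \<open>S 0\<close> equal 1, and for small \<open>h\<close> those
  belonging to one eigenvalue of \<open>H\<close> separate only at order h^(p+1). Multiple
  eigenvalues are exactly where eigenvectors may fail to depend smoothly on a parameter;
  \<open>R\<close> governs the splitting, and (iv) makes it complete. Working with \<open>Y\<close>
  rather than \<open>S\<close> keeps everything real, so the eigenvectors come out real, and since
  \<open>R\<close> is real the leading term of the perturbation lies in \<open>Y\<close>. The
  estimate for \<open>h\<close> tending to 0, combined with smoothness of \<open>S\<close>, becomes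
  an exact factorization with a smooth cofactor, and this exactness permits dividing rows by h^p.
  The quotient of sin (h \<omega>) by h is one and the same function for equal \<omega>, so it
  cancels in the rows that are divided. For \<open>X\<close> only continuity is used: near
  \<open>h = 0\<close> it is close to 1, which selects the positive square root. Roots and
  eigenvectors exist only on an interval around 0, which is why smoothness is developed relative to
  a set.\<close>

primrec ck_on :: "nat \<Rightarrow> real set \<Rightarrow> (real \<Rightarrow> real) \<Rightarrow> bool" where
  "ck_on 0 S f \<longleftrightarrow> continuous_on S f"
| "ck_on (Suc k) S f \<longleftrightarrow>
     (\<exists>f'. (\<forall>x\<in>S. (f has_real_derivative f' x) (at x)) \<and> ck_on k S f')"

text \<open>The finite order \<open>k\<close> is a separate index because the basic closure
  properties are inductions on it. Derivatives are two-sided at each point of \<open>S\<close>, so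
  no boundary convention arises. The set accommodates \<open>sqrt\<close>, \<open>arcsin\<close> and
  the eigenvalue branches, which are smooth only locally.\<close>

definition smooth_on :: "real set \<Rightarrow> (real \<Rightarrow> real) \<Rightarrow> bool" where
  "smooth_on S f \<longleftrightarrow> (\<forall>k. ck_on k S f)"

lemma ck_on_SucI:
  "(\<And>x. x \<in> S \<Longrightarrow> (f has_real_derivative f' x) (at x)) \<Longrightarrow> ck_on k S f' \<Longrightarrow> ck_on (Suc k) S f"
  by auto

text \<open>Derivatives of products, inverses and compositions contain the functions themselves; the
  induction step then needs them at order \<open>k\<close>, while order \<open>Suc k\<close> is what
  is given.\<close>

lemma ck_on_decr: "ck_on (Suc k) S f \<Longrightarrow> ck_on k S f"
proof (induction k arbitrary: f)
  case 0
  then show ?case by (auto intro!: continuous_at_imp_continuous_on intro: DERIV_isCont)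
next
  case (Suc k)
  then obtain f' where f': "\<forall>x\<in>S. (f has_real_derivative f' x) (at x)" "ck_on (Suc k) S f'"
    by (metis ck_on.simps(2))
  then show ?case using Suc.IH by auto
qed

lemma ck_on_subset: "ck_on k S f \<Longrightarrow> T \<subseteq> S \<Longrightarrow> ck_on k T f"
proof (induction k arbitrary: f)
  case 0
  then show ?case by (auto intro: continuous_on_subset)
next
  case (Suc k)
  then obtain f' where f': "\<forall>x\<in>S. (f has_real_derivative f' x) (at x)" "ck_on k S f'"
    by auto
  then show ?case using Suc.IH[of f'] Suc.prems(2) by auto
qed

lemma ck_on_const: "ck_on k S (\<lambda>x. c)"
proof (induction k arbitrary: c)
  case (Suc k)
  show ?case by (rule ck_on_SucI[where f'="\<lambda>x. 0"]) (auto intro: Suc)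
qed auto

lemma ck_on_ident: "ck_on k S (\<lambda>x. x)"
proof (cases k)
  case (Suc k)
  show ?thesis unfolding Suc by (rule ck_on_SucI[where f'="\<lambda>x. 1"]) (auto intro: ck_on_const)
qed auto

lemma ck_on_add: "ck_on k S f \<Longrightarrow> ck_on k S g \<Longrightarrow> ck_on k S (\<lambda>x. f x + g x)"
proof (induction k arbitrary: f g)
  case (Suc k)
  then obtain f' g' where "\<forall>x\<in>S. (f has_real_derivative f' x) (at x)" "ck_on k S f'"
    "\<forall>x\<in>S. (g has_real_derivative g' x) (at x)" "ck_on k S g'" by auto
  then show ?case
    by (intro ck_on_SucI[where f'="\<lambda>x. f' x + g' x"]) (auto intro: Suc.IH DERIV_add)
qed (simp add: continuous_on_add)

lemma ck_on_mult: "ck_on k S f \<Longrightarrow> ck_on k S g \<Longrightarrow> ck_on k S (\<lambda>x. f x * g x)"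
proof (induction k arbitrary: f g)
  case (Suc k)
  then obtain f' g' where fg: "\<forall>x\<in>S. (f has_real_derivative f' x) (at x)" "ck_on k S f'"
    "\<forall>x\<in>S. (g has_real_derivative g' x) (at x)" "ck_on k S g'" by auto
  have "ck_on k S f" "ck_on k S g" using Suc.prems ck_on_decr by blast+
  with fg show ?case
    by (intro ck_on_SucI[where f'="\<lambda>x. f' x * g x + g' x * f x"])
      (auto intro: Suc.IH DERIV_mult ck_on_add)
qed (simp add: continuous_on_mult)

lemma ck_on_inverse:
  "ck_on k S f \<Longrightarrow> (\<And>x. x \<in> S \<Longrightarrow> f x \<noteq> 0) \<Longrightarrow> ck_on k S (\<lambda>x. inverse (f x))"
proof (induction k)
  case (Suc k)
  then obtain f' where f': "\<forall>x\<in>S. (f has_real_derivative f' x) (at x)" "ck_on k S f'" by auto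
  have i: "ck_on k S (\<lambda>x. inverse (f x))" using Suc ck_on_decr by blast
  show ?case
  proof (rule ck_on_SucI[where f'="\<lambda>x. -1 * (inverse (f x) * f' x * inverse (f x))"])
    fix x assume "x \<in> S"
    then show "((\<lambda>x. inverse (f x)) has_real_derivative
        - 1 * (inverse (f x) * f' x * inverse (f x))) (at x)"
      using DERIV_inverse'[of f "f' x" x UNIV] f' Suc.prems by auto
  qed (intro ck_on_mult ck_on_const i f')
qed (simp add: continuous_on_inverse)

lemma ck_on_compose:
  "ck_on k S f \<Longrightarrow> ck_on k T g \<Longrightarrow> (\<And>x. x \<in> S \<Longrightarrow> f x \<in> T) \<Longrightarrow> ck_on k S (\<lambda>x. g (f x))"
proof (induction k arbitrary: g)
  case 0
  then show ?case by (auto intro: continuous_on_compose2[of T g S f])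
next
  case (Suc k)
  then obtain f' g' where fg: "\<forall>x\<in>S. (f has_real_derivative f' x) (at x)" "ck_on k S f'"
    "\<forall>x\<in>T. (g has_real_derivative g' x) (at x)" "ck_on k T g'" by auto
  have "ck_on k S f" using Suc.prems ck_on_decr by blast
  with Suc.IH fg Suc.prems(3) have c: "ck_on k S (\<lambda>x. g' (f x))" by blast
  show ?case
  proof (rule ck_on_SucI[where f'="\<lambda>x. g' (f x) * f' x"])
    fix x assume "x \<in> S"
    then show "((\<lambda>x. g (f x)) has_real_derivative g' (f x) * f' x) (at x)"
      using DERIV_chain2[of g "g' (f x)" f x "f' x" UNIV] fg Suc.prems(3) by auto
  qed (intro ck_on_mult c fg)
qed

lemma ck_on_power: "ck_on k S f \<Longrightarrow> ck_on k S (\<lambda>x. f x ^ n)"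
  by (induction n) (auto intro: ck_on_const ck_on_mult)

lemma ck_on_sum: "(\<And>i. i \<in> I \<Longrightarrow> ck_on k S (f i)) \<Longrightarrow> ck_on k S (\<lambda>x. \<Sum>i\<in>I. f i x)"
  by (induction I rule: infinite_finite_induct) (auto intro: ck_on_const ck_on_add)

lemma smooth_on_subset: "smooth_on S f \<Longrightarrow> T \<subseteq> S \<Longrightarrow> smooth_on T f"
  unfolding smooth_on_def using ck_on_subset by blast

lemma smooth_on_const: "smooth_on S (\<lambda>x. c)"
  by (simp add: smooth_on_def ck_on_const)

lemma smooth_on_ident: "smooth_on S (\<lambda>x. x)"
  by (simp add: smooth_on_def ck_on_ident)

lemma smooth_on_add: "smooth_on S f \<Longrightarrow> smooth_on S g \<Longrightarrow> smooth_on S (\<lambda>x. f x + g x)"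
  by (simp add: smooth_on_def ck_on_add)

lemma smooth_on_mult: "smooth_on S f \<Longrightarrow> smooth_on S g \<Longrightarrow> smooth_on S (\<lambda>x. f x * g x)"
  by (simp add: smooth_on_def ck_on_mult)

lemma smooth_on_minus: "smooth_on S f \<Longrightarrow> smooth_on S (\<lambda>x. - f x)"
  using smooth_on_mult[OF smooth_on_const[of S "-1"], of f] by simp

lemma smooth_on_diff: "smooth_on S f \<Longrightarrow> smooth_on S g \<Longrightarrow> smooth_on S (\<lambda>x. f x - g x)"
  using smooth_on_add[OF _ smooth_on_minus, of S f g] by simp

lemma smooth_on_power: "smooth_on S f \<Longrightarrow> smooth_on S (\<lambda>x. f x ^ n)"
  by (simp add: smooth_on_def ck_on_power)

lemma smooth_on_sum: "(\<And>i. i \<in> I \<Longrightarrow> smooth_on S (f i)) \<Longrightarrow> smooth_on S (\<lambda>x. \<Sum>i\<in>I. f i x)"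
  by (simp add: smooth_on_def ck_on_sum)

lemma smooth_on_prod: "(\<And>i. i \<in> I \<Longrightarrow> smooth_on S (f i)) \<Longrightarrow> smooth_on S (\<lambda>x. \<Prod>i\<in>I. f i x)"
  by (induction I rule: infinite_finite_induct) (auto intro: smooth_on_const smooth_on_mult)

lemma smooth_on_divide:
  "smooth_on S f \<Longrightarrow> smooth_on S g \<Longrightarrow> (\<And>x. x \<in> S \<Longrightarrow> g x \<noteq> 0) \<Longrightarrow> smooth_on S (\<lambda>x. f x / g x)"
  unfolding divide_inverse smooth_on_def using ck_on_mult ck_on_inverse by blast

lemma smooth_on_compose:
  "smooth_on T g \<Longrightarrow> smooth_on S f \<Longrightarrow> (\<And>x. x \<in> S \<Longrightarrow> f x \<in> T) \<Longrightarrow> smooth_on S (\<lambda>x. g (f x))"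
  unfolding smooth_on_def using ck_on_compose by blast

lemma smooth_on_imp_continuous_on: "smooth_on S f \<Longrightarrow> continuous_on S f"
  unfolding smooth_on_def using ck_on.simps(1) by blast

lemma smooth_on_imp_isCont: "smooth_on S f \<Longrightarrow> open S \<Longrightarrow> x \<in> S \<Longrightarrow> isCont f x"
  using smooth_on_imp_continuous_on continuous_on_eq_continuous_at by blast

text \<open>The derivative that \<open>ck_on\<close> only asserts to exist is unique, hence equal to
  \<open>deriv f\<close> independently of \<open>k\<close>. This reconciles the witnesses of the
  different orders.\<close>

lemma ck_on_Suc_deriv:
  assumes "ck_on (Suc k) UNIV f"
  shows "(f has_real_derivative deriv f x) (at x)" "ck_on k UNIV (deriv f)"
proof -
  obtain f' where f': "\<And>x. (f has_real_derivative f' x) (at x)" "ck_on k UNIV f'"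
    using assms by auto
  then have "deriv f = f'" by (auto intro: DERIV_imp_deriv)
  with f' show "(f has_real_derivative deriv f x) (at x)" "ck_on k UNIV (deriv f)" by auto
qed

lemma smooth_on_deriv: "smooth_on UNIV f \<Longrightarrow> smooth_on UNIV (deriv f)"
  using ck_on_Suc_deriv(2) unfolding smooth_on_def by blast

lemma smooth_on_has_deriv: "smooth_on UNIV f \<Longrightarrow> (f has_real_derivative deriv f x) (at x)"
  using ck_on_Suc_deriv(1) unfolding smooth_on_def by blast

text \<open>\<open>smooth\<close> asks for one infinite sequence of derivatives,
  \<open>smooth_on\<close> for a finite chain at each order; the iterates of \<open>deriv\<close>
  join the chains into one sequence.\<close>

lemma smooth_iff_smooth_on: "smooth (f :: real \<Rightarrow> real) \<longleftrightarrow> smooth_on UNIV f"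
proof
  assume "smooth f"
  then obtain F where F: "F 0 = f" "\<And>k x. (F k has_real_derivative F (Suc k) x) (at x)"
    unfolding smooth_def by (auto simp: has_real_derivative_iff_has_vector_derivative)
  have "ck_on k UNIV (F m)" for k m
  proof (induction k arbitrary: m)
    case 0
    show ?case using F(2) by (auto intro!: DERIV_continuous_on)
  next
    case (Suc k)
    show ?case by (rule ck_on_SucI[OF F(2) Suc])
  qed
  then show "smooth_on UNIV f" using F(1) by (auto simp: smooth_on_def)
next
  assume f: "smooth_on UNIV f"
  have "smooth_on UNIV ((deriv ^^ k) f)" for k
    by (induction k) (auto intro: f smooth_on_deriv)
  then show "smooth f" unfolding smooth_def
    by (intro exI[of _ "\<lambda>k. (deriv ^^ k) f"])
      (auto simp flip: has_real_derivative_iff_has_vector_derivative intro: smooth_on_has_deriv)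
qed

lemma ck_on_sin_cos: "ck_on k UNIV (sin :: real \<Rightarrow> real) \<and> ck_on k UNIV (cos :: real \<Rightarrow> real)"
proof (induction k)
  case (Suc k)
  have "ck_on k UNIV (\<lambda>x::real. -1 * sin x)" by (intro ck_on_mult ck_on_const) (use Suc in auto)
  then have "ck_on (Suc k) UNIV (cos :: real \<Rightarrow> real)"
    by (intro ck_on_SucI[where f'="\<lambda>x. -1 * sin x"]) (auto intro!: derivative_eq_intros)
  moreover have "ck_on (Suc k) UNIV (sin :: real \<Rightarrow> real)"
    using Suc by (intro ck_on_SucI[where f'=cos]) (auto intro!: derivative_eq_intros)
  ultimately show ?case by blast
qed (simp add: continuous_on_sin continuous_on_cos continuous_on_id)

lemma smooth_on_sin: "smooth_on UNIV (sin :: real \<Rightarrow> real)"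
  using ck_on_sin_cos by (simp add: smooth_on_def)

lemma smooth_on_cos: "smooth_on UNIV (cos :: real \<Rightarrow> real)"
  using ck_on_sin_cos by (simp add: smooth_on_def)

lemma smooth_on_sqrt: "smooth_on {0<..} sqrt"
  unfolding smooth_on_def
proof
  fix k show "ck_on k {0<..} sqrt"
  proof (induction k)
    case (Suc k)
    show ?case
    proof (rule ck_on_SucI[where f'="\<lambda>x. inverse (sqrt x) * (1/2)"])
      show "ck_on k {0<..} (\<lambda>x. inverse (sqrt x) * (1 / 2))"
        by (intro ck_on_mult ck_on_const ck_on_inverse Suc) auto
    qed (auto intro!: derivative_eq_intros)
  qed (simp add: continuous_on_real_sqrt continuous_on_id)
qed

text \<open>The derivative is an algebraic expression in functions already known to be smooth, so a
  single differentiation settles every order.\<close>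

lemma smooth_on_arcsin: "smooth_on {-1<..<1} arcsin"
  unfolding smooth_on_def
proof
  have *: "x * x < 1" if "-1 < x" "x < 1" for x :: real
    using that abs_square_less_1[of x] by (auto simp: power2_eq_square abs_less_iff)
  have s: "smooth_on {-1<..<1} (\<lambda>x. inverse (sqrt (1 - x*x)))"
  proof -
    have "smooth_on {-1<..<1} (\<lambda>x. 1 / (sqrt (1 - x*x)))"
      by (intro smooth_on_divide smooth_on_const smooth_on_compose[OF smooth_on_sqrt] smooth_on_diff
          smooth_on_mult smooth_on_ident) (auto simp: * dest: *)
    then show ?thesis by (simp add: divide_inverse)
  qed
  fix k show "ck_on k {-1<..<1} arcsin"
  proof (cases k)
    case (Suc m)
    show ?thesis unfolding Suc
      by (rule ck_on_SucI[where f'="\<lambda>x. inverse (sqrt (1 - x*x))"])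
        (use s in \<open>auto simp: smooth_on_def power2_eq_square intro!: derivative_eq_intros\<close>)
  qed (auto intro: continuous_on_add continuous_on_mult continuous_on_inverse continuous_on_real_sqrt continuous_on_id continuous_on_arcsin continuous_on_sin continuous_on_cos)
qed

section \<open>Cutoffs and division by powers\<close>

text \<open>Member 0 is the classical flat function. The powers of \<open>x\<close> in the
  denominator make the family closed under differentiation up to linear combinations, so that
  smoothness is proved for all members at once.\<close>

definition flat_exp :: "nat \<Rightarrow> real \<Rightarrow> real" where
  "flat_exp m x = (if x > 0 then exp (- (1 / x)) / x ^ m else 0)"

lemma flat_exp_tendsto_0: "(flat_exp m \<longlongrightarrow> 0) (at 0)"
proof -
  have "((\<lambda>x::real. exp (- (1 / x)) / x ^ m) \<longlongrightarrow> 0) (at_right 0)"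
    by real_asymp
  then have "(flat_exp m \<longlongrightarrow> 0) (at_right 0)"
    by (rule Lim_transform_eventually)
      (auto simp: flat_exp_def eventually_at_right_less intro: eventually_mono[OF eventually_at_right_less])
  moreover have "(flat_exp m \<longlongrightarrow> 0) (at_left 0)"
    by (rule Lim_transform_eventually[OF tendsto_const])
      (auto simp: flat_exp_def eventually_at_left_field intro!: exI[of _ "-1"])
  ultimately show ?thesis by (simp add: filterlim_at_split)
qed

lemma flat_exp_deriv:
  "(flat_exp m has_real_derivative flat_exp (m + 2) x - real m * flat_exp (m + 1) x) (at x)"
proof -
  consider "x > 0" | "x < 0" | "x = 0" by linarith
  then show ?thesis
  proof cases
    case 1
    have "((\<lambda>x. exp (- (1 / x)) / x ^ m) has_real_derivative
        flat_exp (m + 2) x - real m * flat_exp (m + 1) x) (at x)"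
      using 1
      by (auto intro!: derivative_eq_intros simp: flat_exp_def field_simps power2_eq_square)
        (cases m; simp add: field_simps)+
    then show ?thesis
      by (rule has_field_derivative_transform_within_open[of _ _ _ "{0<..}"])
        (use 1 in \<open>auto simp: flat_exp_def\<close>)
  next
    case 2
    have "((\<lambda>x. 0) has_real_derivative flat_exp (m + 2) x - real m * flat_exp (m + 1) x) (at x)"
      using 2 by (simp add: flat_exp_def)
    then show ?thesis
      by (rule has_field_derivative_transform_within_open[of _ _ _ "{..<0}"])
        (use 2 in \<open>auto simp: flat_exp_def\<close>)
  next
    case 3
    \<comment> \<open>At the origin the difference quotient is again a member of the family, and
      every member tends to 0 there.\<close>
    have "(\<lambda>h. (flat_exp m (0 + h) - flat_exp m 0) / h) = flat_exp (Suc m)"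
      by (auto simp: flat_exp_def)
    then show ?thesis
      using flat_exp_tendsto_0[of "Suc m"] unfolding 3 DERIV_def by (simp add: flat_exp_def)
  qed
qed

lemma smooth_on_flat_exp: "smooth_on UNIV (flat_exp m)"
  unfolding smooth_on_def
proof
  fix k show "ck_on k UNIV (flat_exp m)"
  proof (induction k arbitrary: m)
    case 0
    show ?case using flat_exp_deriv
      by (auto intro!: continuous_at_imp_continuous_on intro: DERIV_isCont)
  next
    case (Suc k)
    have "ck_on k UNIV (\<lambda>x. flat_exp (m + 2) x + (- real m) * flat_exp (m + 1) x)"
      by (intro ck_on_add ck_on_mult ck_on_const Suc)
    then show ?case by (intro ck_on_SucI[OF flat_exp_deriv]) simp
  qed
qed

text \<open>Composing with \<phi> turns a function smooth on an interval around 0 into one smooth on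
  the whole line, without changing it near 0.\<close>

lemma smooth_local_identity:
  fixes \<epsilon> :: real
  assumes "\<epsilon> > 0"
  obtains \<phi> \<delta> where "smooth_on UNIV \<phi>" "\<And>h. \<bar>\<phi> h\<bar> < \<epsilon>" "\<delta> > 0" "\<And>h. \<bar>h\<bar> < \<delta> \<Longrightarrow> \<phi> h = h"
proof -
  \<comment> \<open>\<open>u\<close> is positive exactly for \<bar>h\<bar> < a and \<open>w\<close>
    exactly for \<bar>h\<bar> > a/2, so their sum never vanishes. The quotient u/(u+w) is therefore
    a smooth plateau: 1 up to a/2 and 0 from a on. Taking a below \<epsilon> makes the bound on
    \<phi> strict.\<close>
  define a where "a = \<epsilon> / 2"
  define u where "u h = flat_exp 0 (a^2 - h^2)" for h
  define w where "w h = flat_exp 0 (h^2 - (a/2)^2)" for h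
  define \<phi> where "\<phi> h = h * (u h / (u h + w h))" for h
  have a: "a > 0" "a < \<epsilon>" using assms by (auto simp: a_def)
  have nn: "u h \<ge> 0" "w h \<ge> 0" for h by (auto simp: u_def w_def flat_exp_def)
  have pos: "u h + w h > 0" for h
  proof (cases "h^2 < a^2")
    case True
    then have "u h > 0" by (auto simp: u_def flat_exp_def)
    then show ?thesis using nn[of h] by linarith
  next
    case False
    moreover have "(a/2)^2 < a^2" using a by (simp add: power_divide)
    ultimately have "w h > 0" unfolding w_def flat_exp_def by auto
    then show ?thesis using nn[of h] by linarith
  qed
  have u: "smooth_on UNIV u" unfolding u_def
    by (intro smooth_on_compose[OF smooth_on_flat_exp] smooth_on_diff smooth_on_const smooth_on_power
        smooth_on_ident) auto
  have w: "smooth_on UNIV w" unfolding w_def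
    by (intro smooth_on_compose[OF smooth_on_flat_exp] smooth_on_diff smooth_on_const smooth_on_power
        smooth_on_ident) auto
  have "smooth_on UNIV \<phi>" unfolding \<phi>_def
    by (intro smooth_on_mult smooth_on_divide smooth_on_add smooth_on_ident u w)
      (use pos in \<open>auto simp: less_le\<close>)
  moreover have "\<bar>\<phi> h\<bar> < \<epsilon>" for h
  proof (cases "\<bar>h\<bar> < a")
    case True
    have "\<bar>u h / (u h + w h)\<bar> \<le> 1" using nn[of h] pos[of h] by auto
    then have "\<bar>\<phi> h\<bar> \<le> \<bar>h\<bar> * 1" unfolding \<phi>_def abs_mult by (intro mult_left_mono) auto
    then show ?thesis using True a by linarith
  next
    case False
    then have "a^2 \<le> h^2" using a by (metis abs_le_square_iff abs_of_pos not_less)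
    then have "u h = 0" by (auto simp: u_def flat_exp_def)
    then show ?thesis using assms by (simp add: \<phi>_def)
  qed
  moreover have "\<phi> h = h" if "\<bar>h\<bar> < a/2" for h
  proof -
    have "h^2 \<le> (a/2)^2" using that a by (metis abs_le_square_iff abs_of_pos half_gt_zero less_imp_le)
    then have "w h = 0" by (auto simp: w_def flat_exp_def)
    then show ?thesis using pos[of h] by (simp add: \<phi>_def)
  qed
  ultimately show thesis using that[of \<phi> "a/2"] a by auto
qed

text \<open>The quotient is the integral of the derivative of \<open>f\<close> along the segment from \<open>0\<close> to \<open>x\<close>.\<close>
lemma hadamard:
  fixes f :: "real \<Rightarrow> real"
  assumes f: "smooth_on UNIV f" and f0: "f 0 = 0"
  obtains g where "smooth_on UNIV g" "\<And>x. f x = x * g x" "g 0 = deriv f 0"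
proof -
  define D where "D k = (deriv ^^ k) f" for k
  have smooth_D: "smooth_on UNIV (D k)" for k
    unfolding D_def by (induction k) (auto intro: f smooth_on_deriv)
  have D: "(D k has_real_derivative D (Suc k) x) (at x)" for k x
    using smooth_on_has_deriv[OF smooth_D[of k]] by (simp add: D_def)
  have cont_D: "continuous_on T (\<lambda>x. D k (c x))" if "continuous_on T c"
    for k T and c :: "'a::topological_space \<Rightarrow> real"
    using continuous_on_compose2[OF smooth_on_imp_continuous_on[OF smooth_D] that] by auto
  \<comment> \<open>\<open>G k\<close> is the candidate for the \<open>k\<close>-th derivative of
    the quotient: each differentiation under the integral in \<open>x\<close> yields one more factor
    \<open>t\<close> and one more derivative of \<open>f\<close>.\<close>
  define G where "G k x = integral {0..1} (\<lambda>t::real. t ^ k * D (Suc k) (x * t))" for k x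
  have G_deriv: "(G k has_real_derivative G (Suc k) x) (at x)" for k x
    unfolding G_def
  proof (rule leibniz_rule_field_derivative[where U=UNIV and a="0::real" and b=1, simplified cbox_interval, simplified])
    fix x t :: real
    show "((\<lambda>x. t ^ k * D (Suc k) (x * t)) has_real_derivative t ^ Suc k * D (Suc (Suc k)) (x * t)) (at x)"
      by (rule derivative_eq_intros DERIV_chain2[OF D] refl | simp)+
  next
    fix x :: real
    show "(\<lambda>t. t ^ k * D (Suc k) (x * t)) integrable_on {0..1}"
      by (intro integrable_continuous_real continuous_intros cont_D)
  next
    show "continuous_on (UNIV \<times> {0..1}) (\<lambda>(x, t). t ^ Suc k * D (Suc (Suc k)) (x * t))"
      unfolding case_prod_beta by (intro continuous_intros cont_D)
  qed
  have "ck_on m UNIV (G k)" for m k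
  proof (induction m arbitrary: k)
    case 0
    show ?case using G_deriv
      by (auto intro!: continuous_at_imp_continuous_on intro: DERIV_isCont)
  next
    case (Suc m)
    show ?case by (rule ck_on_SucI[OF G_deriv Suc])
  qed
  moreover have "f x = x * G 0 x" for x
  proof -
    have d: "((\<lambda>t. f (x * t)) has_real_derivative x * D (Suc 0) (x * t)) (at t)" for t
      using DERIV_chain2[OF smooth_on_has_deriv[OF f] DERIV_cmult_Id, of x t UNIV]
      by (simp add: D_def mult.commute)
    have "((\<lambda>t. x * D (Suc 0) (x * t)) has_integral (f (x * 1) - f (x * 0))) {0..1}"
      by (rule fundamental_theorem_of_calculus[where f="\<lambda>t. f (x * t)"])
        (auto simp flip: has_real_derivative_iff_has_vector_derivative intro: has_field_derivative_at_within d)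
    from integral_unique[OF this] show ?thesis by (simp add: f0 G_def)
  qed
  moreover have "G 0 0 = deriv f 0" by (simp add: G_def D_def)
  ultimately show thesis using that[of "G 0"] by (auto simp: smooth_on_def)
qed

text \<open>One factor \<open>h\<close> is split off at a time: the estimate makes \<open>f\<close>
  tend to 0, continuity turns the limit into \<open>f 0 = 0\<close>, and \<open>hadamard\<close>
  divides. The estimate ignores the point 0 itself, so continuity is also what identifies the last
  quotient's value there with \<open>c\<close>.\<close>

lemma smooth_divide_power:
  fixes f :: "real \<Rightarrow> real"
  assumes "smooth_on UNIV f" and "(\<lambda>h. f h - c * h ^ m) \<in> O[at 0](\<lambda>h. h ^ Suc m)"
  obtains g where "smooth_on UNIV g" "\<And>h. f h = h ^ m * g h" "g 0 = c"
  using assms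
proof (induction m arbitrary: f thesis)
  have lim0: "((\<lambda>h. r h) \<longlongrightarrow> 0) (at 0)" if "r \<in> O[at 0](\<lambda>h. h ^ Suc m)" for r :: "real \<Rightarrow> real" and m
  proof -
    have "(\<lambda>h::real. h ^ Suc m) \<in> o[at 0](\<lambda>_. 1)"
      by (rule smalloI_tendsto) (auto intro!: tendsto_eq_intros)
    then have "r \<in> o[at 0](\<lambda>_. 1)" using that landau_o.big_small_trans by blast
    then show ?thesis by (rule smalloD_tendsto[where g="\<lambda>_. 1", simplified])
  qed
  {
    case 0
    have "((\<lambda>h. f h - c) \<longlongrightarrow> 0) (at 0)" using lim0[OF 0(3)] by simp
    then have "(f \<longlongrightarrow> c) (at 0)" by (simp add: LIM_zero_iff)
    moreover have "(f \<longlongrightarrow> f 0) (at 0)"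
      using smooth_on_imp_isCont[OF 0(2)] by (simp add: isCont_def)
    ultimately have "f 0 = c" using tendsto_unique trivial_limit_at by blast
    with 0 show ?case by auto
  next
    case (Suc m)
    have "((\<lambda>h. f h - c * h ^ Suc m) \<longlongrightarrow> 0) (at 0)" using lim0[OF Suc(4)] .
    moreover have "((\<lambda>h. c * h ^ Suc m) \<longlongrightarrow> 0) (at 0)" by (auto intro!: tendsto_eq_intros)
    ultimately have "((\<lambda>h. (f h - c * h ^ Suc m) + c * h ^ Suc m) \<longlongrightarrow> 0 + 0) (at 0)"
      by (rule tendsto_add)
    then have "(f \<longlongrightarrow> 0) (at 0)" by simp
    moreover have "(f \<longlongrightarrow> f 0) (at 0)"
      using smooth_on_imp_isCont[OF Suc(3)] by (simp add: isCont_def)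
    ultimately have "f 0 = 0" using tendsto_unique trivial_limit_at by blast
    then obtain f1 where f1: "smooth_on UNIV f1" "\<And>x. f x = x * f1 x"
      using hadamard[OF Suc(3)] by blast
    have "(\<lambda>h. h * (f1 h - c * h ^ m)) \<in> O[at 0](\<lambda>h. h * h ^ Suc m)"
      using Suc(4) by (simp add: f1(2) algebra_simps)
    then have "(\<lambda>h. f1 h - c * h ^ m) \<in> O[at 0](\<lambda>h. h ^ Suc m)"
      by (subst (asm) landau_o.big.mult_cancel_left) (auto simp: eventually_at_filter)
    then obtain g where "smooth_on UNIV g" "\<And>h. f1 h = h ^ m * g h" "g 0 = c"
      using Suc(1)[OF _ f1(1)] by blast
    then show ?case using Suc(2)[of g] f1(2) by (simp add: mult.assoc)
  }
qed

section \<open>Smooth dependence of simple roots\<close>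

text \<open>The degree bound is uniform in \<open>h\<close>, so that evaluation is a sum over a
  fixed finite range and inherits smoothness or limits from the coefficients.\<close>

definition smooth_poly :: "(real \<Rightarrow> real poly) \<Rightarrow> bool" where
  "smooth_poly Q \<longleftrightarrow> (\<exists>n. \<forall>h. degree (Q h) \<le> n) \<and> (\<forall>j. smooth_on UNIV (\<lambda>h. poly.coeff (Q h) j))"

lemma smooth_polyI:
  "(\<And>h. degree (Q h) \<le> n) \<Longrightarrow> (\<And>j. smooth_on UNIV (\<lambda>h. poly.coeff (Q h) j)) \<Longrightarrow> smooth_poly Q"
  by (auto simp: smooth_poly_def)

lemma smooth_poly_linear:
  "smooth_on UNIV a \<Longrightarrow> smooth_on UNIV b \<Longrightarrow> smooth_poly (\<lambda>h. [:a h, b h:])"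
proof (rule smooth_polyI[of _ 1])
  fix j
  assume "smooth_on UNIV a" "smooth_on UNIV b"
  then show "smooth_on UNIV (\<lambda>h. poly.coeff [:a h, b h:] j)"
    by (cases j; cases "j - 1") (simp_all add: coeff_pCons smooth_on_const)
qed auto

lemma smooth_poly_const: "smooth_on UNIV a \<Longrightarrow> smooth_poly (\<lambda>h. [:a h:])"
  using smooth_poly_linear[of a "\<lambda>_. 0"] by (simp add: smooth_on_const)

lemma smooth_poly_add: "smooth_poly P \<Longrightarrow> smooth_poly Q \<Longrightarrow> smooth_poly (\<lambda>h. P h + Q h)"
proof -
  assume "smooth_poly P" "smooth_poly Q"
  then obtain m n where "\<And>h. degree (P h) \<le> m" "\<And>h. degree (Q h) \<le> n"
    and s: "\<And>j. smooth_on UNIV (\<lambda>h. poly.coeff (P h) j)" "\<And>j. smooth_on UNIV (\<lambda>h. poly.coeff (Q h) j)"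
    by (auto simp: smooth_poly_def)
  then have "degree (P h + Q h) \<le> max m n" for h
    by (meson degree_add_le max.coboundedI1 max.coboundedI2)
  then show ?thesis by (rule smooth_polyI) (simp add: smooth_on_add s)
qed

lemma smooth_poly_mult: "smooth_poly P \<Longrightarrow> smooth_poly Q \<Longrightarrow> smooth_poly (\<lambda>h. P h * Q h)"
proof -
  assume "smooth_poly P" "smooth_poly Q"
  then obtain m n where d: "\<And>h. degree (P h) \<le> m" "\<And>h. degree (Q h) \<le> n"
    and s: "\<And>j. smooth_on UNIV (\<lambda>h. poly.coeff (P h) j)" "\<And>j. smooth_on UNIV (\<lambda>h. poly.coeff (Q h) j)"
    by (auto simp: smooth_poly_def)
  have "degree (P h * Q h) \<le> m + n" for h
    using degree_mult_le[of "P h" "Q h"] d[of h] by linarith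
  then show ?thesis
    by (rule smooth_polyI) (unfold coeff_mult, intro smooth_on_sum smooth_on_mult s)
qed

lemma smooth_poly_sum: "(\<And>i. i \<in> I \<Longrightarrow> smooth_poly (f i)) \<Longrightarrow> smooth_poly (\<lambda>h. \<Sum>i\<in>I. f i h)"
proof (induction I rule: infinite_finite_induct)
  case (insert x F)
  then show ?case using smooth_poly_add[of "f x" "\<lambda>h. \<Sum>i\<in>F. f i h"] by simp
qed (use smooth_poly_const[OF smooth_on_const[of _ 0]] in simp_all)

lemma smooth_poly_prod: "(\<And>i. i \<in> I \<Longrightarrow> smooth_poly (f i)) \<Longrightarrow> smooth_poly (\<lambda>h. \<Prod>i\<in>I. f i h)"
proof (induction I rule: infinite_finite_induct)
  case (insert x F)
  then show ?case using smooth_poly_mult[of "f x" "\<lambda>h. \<Prod>i\<in>F. f i h"] by simp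
qed (use smooth_poly_const[OF smooth_on_const[of _ 1]] in \<open>simp_all flip: pCons_one\<close>)

lemma smooth_poly_pderiv: "smooth_poly Q \<Longrightarrow> smooth_poly (\<lambda>h. pderiv (Q h))"
proof -
  assume "smooth_poly Q"
  then obtain n where n: "\<And>h. degree (Q h) \<le> n"
    and s: "\<And>j. smooth_on UNIV (\<lambda>h. poly.coeff (Q h) j)"
    by (auto simp: smooth_poly_def)
  have "degree (pderiv (Q h)) \<le> n" for h
    using n[of h] by (simp add: degree_pderiv)
  then show ?thesis
    by (rule smooth_polyI) (unfold coeff_pderiv, intro smooth_on_mult smooth_on_const s)
qed

lemma poly_eq_sum_atMost:
  fixes p :: "'a::comm_semiring_1 poly"
  assumes "degree p \<le> n"
  shows "poly p x = (\<Sum>j\<le>n. poly.coeff p j * x ^ j)"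
  unfolding poly_altdef using assms
  by (intro sum.mono_neutral_left) (auto simp: coeff_eq_0)

lemma smooth_poly_ck_on_eval:
  assumes "smooth_poly Q" "ck_on k S L"
  shows "ck_on k S (\<lambda>h. poly (Q h) (L h))"
proof -
  obtain n where n: "\<And>h. degree (Q h) \<le> n"
    and s: "\<And>j. smooth_on UNIV (\<lambda>h. poly.coeff (Q h) j)"
    using assms by (auto simp: smooth_poly_def)
  have "ck_on k S (\<lambda>h. poly.coeff (Q h) j)" for j
    using s smooth_on_def ck_on_subset[OF _ subset_UNIV] by blast
  then show ?thesis unfolding poly_eq_sum_atMost[OF n]
    by (intro ck_on_sum ck_on_mult ck_on_power assms)
qed

lemma smooth_poly_tendsto_eval:
  assumes "smooth_poly Q" "(c \<longlongrightarrow> c0) F" "(l \<longlongrightarrow> l0) F"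
  shows "((\<lambda>t. poly (Q (c t)) (l t)) \<longlongrightarrow> poly (Q c0) l0) F"
proof -
  obtain n where n: "\<And>h. degree (Q h) \<le> n"
    and s: "\<And>j. smooth_on UNIV (\<lambda>h. poly.coeff (Q h) j)"
    using assms by (auto simp: smooth_poly_def)
  have "((\<lambda>t. poly.coeff (Q (c t)) j) \<longlongrightarrow> poly.coeff (Q c0) j) F" for j
    using isCont_tendsto_compose[OF smooth_on_imp_isCont[OF s open_UNIV] assms(2)] by auto
  then show ?thesis unfolding poly_eq_sum_atMost[OF n]
    by (intro tendsto_sum tendsto_mult tendsto_power assms)
qed

text \<open>The two bounds serve different ends: the first forces \<xi> to \<open>y\<close> when
  \<open>x\<close> tends to \<open>y\<close>, the second keeps \<xi> inside any interval around
  \<open>z\<close> that contains \<open>x\<close> and \<open>y\<close>. Admitting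
  \<open>x = y\<close> spares case distinctions.\<close>

lemma poly_mean_value:
  fixes p :: "real poly"
  shows "\<exists>\<xi>. \<bar>\<xi> - y\<bar> \<le> \<bar>x - y\<bar> \<and> \<bar>\<xi> - z\<bar> \<le> max \<bar>x - z\<bar> \<bar>y - z\<bar> \<and>
    poly p x - poly p y = (x - y) * poly (pderiv p) \<xi>"
proof (cases x y rule: linorder_cases)
  case less
  obtain \<xi> where "x < \<xi>" "\<xi> < y" "poly p y - poly p x = (y - x) * poly (pderiv p) \<xi>"
    using poly_MVT[OF less, of p] by blast
  then show ?thesis by (intro exI[of _ \<xi>]) (auto simp: algebra_simps)
next
  case greater
  obtain \<xi> where "y < \<xi>" "\<xi> < x" "poly p x - poly p y = (x - y) * poly (pderiv p) \<xi>"
    using poly_MVT[OF greater, of p] by blast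
  then show ?thesis by (intro exI[of _ \<xi>]) auto
qed (auto intro: exI[of _ y])

text \<open>The root inherits one derivative after the other from its own differential equation.\<close>
lemma implicit_root_normalized:
  fixes Q :: "real \<Rightarrow> real poly"
  assumes Q: "smooth_poly Q" and root: "poly (Q 0) l0 = 0" and d1: "poly (pderiv (Q 0)) l0 = 1"
  obtains \<epsilon> L where "\<epsilon> > 0" "L 0 = l0" "\<And>h. \<bar>h\<bar> < \<epsilon> \<Longrightarrow> poly (Q h) (L h) = 0"
    "smooth_on {-\<epsilon><..<\<epsilon>} L"
proof -
  define b where "b h x = poly (pderiv (Q h)) x" for h x
  note Q' = smooth_poly_pderiv[OF Q]
  have "((\<lambda>z. b (fst z) (snd z)) \<longlongrightarrow> b 0 l0) (nhds (0, l0))"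
    unfolding b_def
    using smooth_poly_tendsto_eval[OF Q', of fst 0 "nhds (0, l0)" snd l0]
      tendsto_fst[OF filterlim_ident, of "(0::real, l0)"] tendsto_snd[OF filterlim_ident, of "(0::real, l0)"]
    by simp
  then have "\<forall>\<^sub>F z in nhds (0, l0). dist (b (fst z) (snd z)) 1 < 1/2"
    using tendstoD[where e="1/2" and l=1] d1 by (simp add: b_def)
  then obtain d where d: "d > 0" "\<And>z. dist z (0, l0) < d \<Longrightarrow> dist (b (fst z) (snd z)) 1 < 1/2"
    unfolding eventually_nhds_metric by blast
  \<comment> \<open>A third suffices because the product distance is at most the sum of two
    distances, each at most \<open>r\<close>, and 2d/3 < d.\<close>
  define r where "r = d / 3"
  have r: "r > 0" using d by (simp add: r_def)
  have b_lower: "1/2 \<le> b h x" if "\<bar>h\<bar> \<le> r" "\<bar>x - l0\<bar> \<le> r" for h x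
  proof -
    have "dist (h, x) (0, l0) \<le> \<bar>h\<bar> + \<bar>x - l0\<bar>"
      unfolding dist_prod_def by (simp add: dist_real_def sqrt_sum_squares_le_sum_abs[of h "x - l0", simplified])
    also have "\<dots> < d" using that d by (simp add: r_def)
    finally have "\<bar>b h x - 1\<bar> < 1/2" using d(2)[of "(h, x)"] by (simp add: dist_real_def)
    then show ?thesis by linarith
  qed
  \<comment> \<open>On the square of radius \<open>r\<close> each polynomial increases with slope at
    least 1/2. The first bound controls a root by its defect; the second gives the sign change used
    for existence.\<close>
  have expand: "\<bar>x - y\<bar> \<le> 2 * \<bar>poly (Q h) x - poly (Q h) y\<bar> \<and>
      (x > y \<longrightarrow> (x - y) / 2 \<le> poly (Q h) x - poly (Q h) y)"
    if h: "\<bar>h\<bar> \<le> r" and x: "\<bar>x - l0\<bar> \<le> r" and y: "\<bar>y - l0\<bar> \<le> r" for h x y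
  proof -
    obtain \<xi> where \<xi>: "\<bar>\<xi> - l0\<bar> \<le> max \<bar>x - l0\<bar> \<bar>y - l0\<bar>"
      "poly (Q h) x - poly (Q h) y = (x - y) * b h \<xi>"
      unfolding b_def using poly_mean_value[of y x l0 "Q h"] by blast
    have low: "1/2 \<le> b h \<xi>" using b_lower[OF h] \<xi>(1) x y by auto
    then have "\<bar>x - y\<bar> * (1/2) \<le> \<bar>x - y\<bar> * \<bar>b h \<xi>\<bar>" by (intro mult_left_mono) auto
    moreover have "(x - y) * (1/2) \<le> (x - y) * b h \<xi>" if "x > y" using low that by (intro mult_left_mono) auto
    ultimately show ?thesis unfolding \<xi>(2) abs_mult by auto
  qed
  have "((\<lambda>h. poly (Q h) l0) \<longlongrightarrow> poly (Q 0) l0) (nhds 0)"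
    by (rule smooth_poly_tendsto_eval[OF Q filterlim_ident tendsto_const])
  then have "((\<lambda>h. poly (Q h) l0) \<longlongrightarrow> 0) (nhds 0)" by (simp add: root)
  \<comment> \<open>With slope at least 1/2 the value changes by at least r/2 over a distance
    \<open>r\<close>, so a value below r/2 at \<open>l0\<close> forces opposite signs at the two
    ends.\<close>
  then have "\<forall>\<^sub>F h in nhds 0. dist (poly (Q h) l0) 0 < r / 2"
    using r by (intro tendstoD) auto
  then obtain e where e: "e > 0" "\<And>h. \<bar>h\<bar> < e \<Longrightarrow> \<bar>poly (Q h) l0\<bar> < r / 2"
    unfolding eventually_nhds_metric by (auto simp: dist_real_def)
  define \<epsilon> where "\<epsilon> = min r e"
  have \<epsilon>: "\<epsilon> > 0" using r e by (simp add: \<epsilon>_def)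
  have "\<exists>x. \<bar>x - l0\<bar> \<le> r \<and> poly (Q h) x = 0" if h: "\<bar>h\<bar> < \<epsilon>" for h
  proof -
    have q: "\<bar>poly (Q h) l0\<bar> < r / 2" "\<bar>h\<bar> \<le> r" using h e by (auto simp: \<epsilon>_def)
    have "poly (Q h) (l0 + r) > 0" using expand[of h "l0 + r" l0] q r by auto
    moreover have "poly (Q h) (l0 - r) < 0" using expand[of h l0 "l0 - r"] q r by auto
    ultimately obtain x where "l0 - r < x" "x < l0 + r" "poly (Q h) x = 0"
      using poly_IVT_pos[of "l0 - r" "l0 + r" "Q h"] r by auto
    then show ?thesis by (intro exI[of _ x]) auto
  qed
  then obtain L where L: "\<And>h. \<bar>h\<bar> < \<epsilon> \<Longrightarrow> \<bar>L h - l0\<bar> \<le> r" "\<And>h. \<bar>h\<bar> < \<epsilon> \<Longrightarrow> poly (Q h) (L h) = 0"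
    by metis
  have "L 0 = l0"
    using expand[of 0 "L 0" l0] L[of 0] \<epsilon> r root by auto
  have ev: "\<forall>\<^sub>F h in at h1. \<bar>h\<bar> < \<epsilon>" if "\<bar>h1\<bar> < \<epsilon>" for h1
    using eventually_at_in_open'[of "{-\<epsilon><..<\<epsilon>}" h1] that
    by (auto simp: abs_less_iff elim!: eventually_mono)
  \<comment> \<open>Continuity has to precede differentiability: the mean value points in the
    difference quotient converge only because \<open>L\<close> does. It follows since the defect of
    \<open>L h1\<close> at the parameter \<open>h\<close> tends to 0.\<close>
  have L_tendsto: "(L \<longlongrightarrow> L h1) (at h1)" if h1: "\<bar>h1\<bar> < \<epsilon>" for h1
  proof -
    have "((\<lambda>h. poly (Q h) (L h1)) \<longlongrightarrow> poly (Q h1) (L h1)) (at h1)"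
      by (rule smooth_poly_tendsto_eval[OF Q tendsto_ident_at tendsto_const])
    then have "((\<lambda>h. poly (Q h) (L h1)) \<longlongrightarrow> 0) (at h1)" by (simp add: L(2)[OF h1])
    then have "((\<lambda>h. L h - L h1) \<longlongrightarrow> 0) (at h1)"
    proof (rule tendsto_0_le[where K=2])
      show "\<forall>\<^sub>F h in at h1. norm (L h - L h1) \<le> norm (poly (Q h) (L h1)) * 2"
        using ev[OF h1]
      proof eventually_elim
        case (elim h)
        then have "\<bar>h\<bar> \<le> r" by (simp add: \<epsilon>_def)
        from expand[OF this L(1)[OF elim] L(1)[OF h1]] L(2)[OF elim] show ?case by auto
      qed
    qed
    then show ?thesis by (simp add: LIM_zero_iff)
  qed
  obtain n where n: "\<And>h. degree (Q h) \<le> n"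
    and sm: "\<And>j. smooth_on UNIV (\<lambda>h. poly.coeff (Q h) j)"
    using Q by (auto simp: smooth_poly_def)
  define Qd where "Qd h x = (\<Sum>j\<le>n. deriv (\<lambda>h. poly.coeff (Q h) j) h * x ^ j)" for h x
  have L_deriv: "(L has_real_derivative - Qd h (L h) * inverse (b h (L h))) (at h)"
    if h1: "\<bar>h\<bar> < \<epsilon>" for h
  proof -
    have hr: "\<bar>h\<bar> \<le> r" using h1 by (simp add: \<epsilon>_def)
    \<comment> \<open>Both \<open>L t\<close> and \<open>L h\<close> are roots, for different
      parameters. Comparing them inside the one polynomial \<open>Q t\<close> expresses the
      increment of \<open>L\<close> by the change of \<open>Q\<close> at the fixed argument
      \<open>L h\<close>, divided by a slope at \<open>X t\<close>.\<close>
    have "\<forall>t. \<exists>\<xi>. \<bar>\<xi> - L h\<bar> \<le> \<bar>L t - L h\<bar> \<and> \<bar>\<xi> - l0\<bar> \<le> max \<bar>L t - l0\<bar> \<bar>L h - l0\<bar> \<and>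
        poly (Q t) (L t) - poly (Q t) (L h) = (L t - L h) * b t \<xi>"
      unfolding b_def by (intro allI poly_mean_value)
    from choice[OF this] obtain X where
      X: "\<And>t. \<bar>X t - L h\<bar> \<le> \<bar>L t - L h\<bar>"
        "\<And>t. \<bar>X t - l0\<bar> \<le> max \<bar>L t - l0\<bar> \<bar>L h - l0\<bar>"
        "\<And>t. poly (Q t) (L t) - poly (Q t) (L h) = (L t - L h) * b t (X t)" by blast
    have "((\<lambda>t. L t - L h) \<longlongrightarrow> 0) (at h)" using L_tendsto[OF h1] by (simp add: LIM_zero)
    then have "((\<lambda>t. X t - L h) \<longlongrightarrow> 0) (at h)"
      by (rule tendsto_0_le[where K=1]) (use X(1) in auto)
    then have "(X \<longlongrightarrow> L h) (at h)" by (simp add: LIM_zero_iff)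
    then have b_lim: "((\<lambda>t. b t (X t)) \<longlongrightarrow> b h (L h)) (at h)"
      unfolding b_def by (rule smooth_poly_tendsto_eval[OF Q' tendsto_ident_at])
    have "((\<lambda>t. poly (Q t) (L h)) has_real_derivative Qd h (L h)) (at h)"
      unfolding Qd_def poly_eq_sum_atMost[OF n]
      by (intro DERIV_sum DERIV_cmult_right smooth_on_has_deriv sm)
    then have q_lim: "((\<lambda>t. (poly (Q t) (L h) - poly (Q h) (L h)) / (t - h)) \<longlongrightarrow> Qd h (L h)) (at h)"
      by (simp add: has_field_derivative_iff)
    have "b h (L h) \<noteq> 0" using b_lower[OF hr L(1)[OF h1]] by auto
    from tendsto_mult[OF tendsto_minus[OF q_lim] tendsto_inverse[OF b_lim this]]
    have "((\<lambda>t. (L t - L h) / (t - h)) \<longlongrightarrow> - Qd h (L h) * inverse (b h (L h))) (at h)"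
    proof (rule Lim_transform_eventually)
      show "\<forall>\<^sub>F t in at h. - ((poly (Q t) (L h) - poly (Q h) (L h)) / (t - h)) * inverse (b t (X t))
          = (L t - L h) / (t - h)"
        using ev[OF h1]
      proof eventually_elim
        case (elim t)
        have "\<bar>X t - l0\<bar> \<le> r" using X(2)[of t] L(1)[OF h1] L(1)[OF elim] by auto
        then have "b t (X t) \<noteq> 0" using b_lower[of t "X t"] elim by (auto simp: \<epsilon>_def)
        moreover have "poly (Q t) (L h) = - ((L t - L h) * b t (X t))"
          using X(3)[of t] L(2)[OF elim] by simp
        ultimately show ?case using L(2)[OF h1] by simp
      qed
    qed
    then show ?thesis by (simp add: has_field_derivative_iff)
  qed
  have "smooth_on {-\<epsilon><..<\<epsilon>} L"
    unfolding smooth_on_def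
  proof
    fix k show "ck_on k {-\<epsilon><..<\<epsilon>} L"
    proof (induction k)
      case 0
      have "isCont L x" if "x \<in> {-\<epsilon><..<\<epsilon>}" for x
        using DERIV_isCont[OF L_deriv[of x]] that by auto
      then show ?case by (simp add: continuous_at_imp_continuous_on)
    next
      case (Suc k)
      have dsm: "ck_on k {-\<epsilon><..<\<epsilon>} (deriv (\<lambda>h. poly.coeff (Q h) j))" for j
        using smooth_on_deriv[OF sm] smooth_on_def ck_on_subset[OF _ subset_UNIV] by blast
      have "ck_on k {-\<epsilon><..<\<epsilon>} (\<lambda>h. -1 * (Qd h (L h) * inverse (b h (L h))))"
        unfolding Qd_def b_def
      proof (intro ck_on_mult ck_on_const ck_on_sum ck_on_power ck_on_inverse Suc dsm
          smooth_poly_ck_on_eval[OF Q'])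
        fix x assume "x \<in> {-\<epsilon><..<\<epsilon>}"
        then have "\<bar>x\<bar> < \<epsilon>" by auto
        then show "poly (pderiv (Q x)) (L x) \<noteq> 0"
          using b_lower[OF _ L(1), of x x] by (auto simp: \<epsilon>_def b_def)
      qed
      then show ?case
        by (intro ck_on_SucI[OF L_deriv]) (auto simp: abs_less_iff)
    qed
  qed
  then show thesis using that \<epsilon> \<open>L 0 = l0\<close> L(2) by blast
qed

text \<open>Rescaling the family by a constant leaves its roots alone and normalizes the slope at
  the base point, so that fixed numerical bounds can be used.\<close>

lemma implicit_root:
  fixes Q :: "real \<Rightarrow> real poly"
  assumes Q: "smooth_poly Q" and root: "poly (Q 0) l0 = 0" and d: "poly (pderiv (Q 0)) l0 \<noteq> 0"
  obtains \<epsilon> L where "\<epsilon> > 0" "L 0 = l0" "\<And>h. \<bar>h\<bar> < \<epsilon> \<Longrightarrow> poly (Q h) (L h) = 0"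
    "smooth_on {-\<epsilon><..<\<epsilon>} L"
proof -
  define c where "c = inverse (poly (pderiv (Q 0)) l0)"
  have c: "c \<noteq> 0" using d by (simp add: c_def)
  have "smooth_poly (\<lambda>h. [:c:] * Q h)"
    by (intro smooth_poly_mult Q smooth_poly_const smooth_on_const)
  then have s: "smooth_poly (\<lambda>h. Polynomial.smult c (Q h))" by simp
  show thesis
    by (rule implicit_root_normalized[OF s, of l0])
      (use root d c that in \<open>auto simp: pderiv_smult c_def\<close>)
qed

section \<open>Diagonal matrices and spectral projectors\<close>

lemma has_vector_derivative_matI:
  fixes M :: "real \<Rightarrow> real^'n^'m"
  assumes "\<And>i j. ((\<lambda>h. M h $ i $ j) has_real_derivative M' $ i $ j) (at x)"
  shows "(M has_vector_derivative M') (at x)"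
  unfolding has_vector_derivative_def
proof (subst has_derivative_componentwise_within, intro ballI)
  fix b :: "real^'n^'m"
  assume "b \<in> Basis"
  then obtain i u where b: "b = axis i u" "u \<in> Basis" by (auto simp: Basis_vec_def)
  from b(2) obtain j where u: "u = axis j 1" by (auto simp: Basis_vec_def)
  have "((\<lambda>h. M h $ i $ j) has_derivative (\<lambda>t. M' $ i $ j * t)) (at x)"
    using assms[of i j] by (simp add: has_field_derivative_def)
  then show "((\<lambda>h. M h \<bullet> b) has_derivative (\<lambda>h. (h *\<^sub>R M') \<bullet> b)) (at x)"
    by (simp add: b u inner_axis mult.commute)
qed

lemma smooth_matI:
  fixes M :: "real \<Rightarrow> real^'n^'m"
  assumes "\<And>i j. smooth_on UNIV (\<lambda>h. M h $ i $ j)"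
  shows "smooth M"
proof -
  define F where "F k h = (\<chi> i j. (deriv ^^ k) (\<lambda>h. M h $ i $ j) h)" for k h
  have s: "smooth_on UNIV ((deriv ^^ k) (\<lambda>h. M h $ i $ j))" for k i j
    by (induction k) (auto intro: assms smooth_on_deriv)
  have "F 0 = M" by (simp add: F_def fun_eq_iff vec_eq_iff)
  moreover have "(F k has_vector_derivative F (Suc k) x) (at x)" for k x
    by (rule has_vector_derivative_matI) (use smooth_on_has_deriv[OF s] in \<open>simp add: F_def\<close>)
  ultimately show ?thesis unfolding smooth_def by blast
qed

lemma smooth_bounded_linear:
  assumes "bounded_linear l" "smooth f"
  shows "smooth (\<lambda>h. l (f h))"
proof -
  obtain F where F: "F 0 = f" "\<And>k x. (F k has_vector_derivative F (Suc k) x) (at x)"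
    using assms(2) unfolding smooth_def by blast
  then show ?thesis unfolding smooth_def
    by (intro exI[of _ "\<lambda>k h. l (F k h)"])
      (auto intro: bounded_linear.has_vector_derivative[OF assms(1)])
qed

section \<open>Diagonal matrices, inverses, complexification and the exponential\<close>

definition diagm :: "('n \<Rightarrow> 'a::zero) \<Rightarrow> 'a^'n^'n" where
  "diagm a = (\<chi> i j. if i = j then a i else 0)"

lemma diagm_nth: "diagm a $ i $ j = (if i = j then a i else 0)"
  by (simp add: diagm_def)

lemma diagonal_diagm: "diagonal (diagm a)"
  by (simp add: diagonal_def diagm_nth)

lemma diagonal_imp_diagm: "diagonal A \<Longrightarrow> A = diagm (\<lambda>i. A $ i $ i)"
  by (auto simp: diagonal_def vec_eq_iff diagm_nth)

lemma mult_diagm_nth: "(A ** diagm a) $ i $ j = A $ i $ j * (a j :: 'a::semiring_1)"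
  by (simp add: matrix_matrix_mult_def diagm_nth if_distrib sum.delta cong: if_cong)

lemma diagm_mult_nth: "(diagm a ** A) $ i $ j = (a i :: 'a::semiring_1) * A $ i $ j"
  by (simp add: matrix_matrix_mult_def diagm_nth if_distrib if_distribR sum.delta' cong: if_cong)

lemma diagm_vector_nth: "(diagm a *v x) $ i = (a i :: 'a::semiring_1) * x $ i"
  by (simp add: matrix_vector_mult_def diagm_nth if_distrib if_distribR sum.delta' cong: if_cong)

lemma diagm_mult_diagm: "diagm a ** diagm b = diagm (\<lambda>i. a i * (b i :: 'a::semiring_1))"
  by (simp add: vec_eq_iff mult_diagm_nth) (simp add: diagm_nth)

lemma diagm_one: "diagm (\<lambda>_. 1) = (Finite_Cartesian_Product.mat 1 :: 'a::semiring_1^'n^'n)"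
  by (simp add: vec_eq_iff diagm_nth Finite_Cartesian_Product.mat_def)

lemma matrix_inv_right_left:
  "invertible (A :: 'a::semiring_1^'n^'m) \<Longrightarrow>
    A ** matrix_inv A = Finite_Cartesian_Product.mat 1 \<and> matrix_inv A ** A = Finite_Cartesian_Product.mat 1"
  unfolding invertible_def matrix_inv_def by (rule someI_ex)

lemma inverse_matrix_unique:
  fixes A :: "'a::semiring_1^'n^'m"
  assumes "A ** B = Finite_Cartesian_Product.mat 1" "B ** A = Finite_Cartesian_Product.mat 1"
  shows "invertible A" "matrix_inv A = B"
proof -
  show i: "invertible A" unfolding invertible_def using assms by blast
  have "matrix_inv A = matrix_inv A ** (A ** B)" by (simp add: assms)
  also have "\<dots> = B" using matrix_inv_right_left[OF i] by (simp add: matrix_mul_assoc)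
  finally show "matrix_inv A = B" .
qed

lemma cmat_mult: "cmat (A ** B) = cmat A ** cmat B"
  by (simp add: vec_eq_iff matrix_matrix_mult_def)

lemma cmat_one: "cmat (Finite_Cartesian_Product.mat 1) = Finite_Cartesian_Product.mat 1"
  by (simp add: vec_eq_iff Finite_Cartesian_Product.mat_def)

lemma cmat_diagm: "cmat (diagm a) = diagm (\<lambda>i. complex_of_real (a i))"
  by (simp add: vec_eq_iff diagm_nth)

lemma det_cmat: "Determinants.det (cmat A) = of_real (Determinants.det A)"
  by (simp add: Determinants.det_def)

lemma invertible_cmat_iff: "invertible (cmat A) \<longleftrightarrow> invertible (A :: real^'n^'n)"
  by (simp add: invertible_det_nz det_cmat)

lemma matrix_inv_cmat: "invertible A \<Longrightarrow> matrix_inv (cmat A) = cmat (matrix_inv A)"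
  by (rule inverse_matrix_unique) (simp_all add: matrix_inv_right_left cmat_one flip: cmat_mult)

text \<open>The inner factors \<open>Q' ** Q\<close> cancel in every power, so each entry of the
  series is a finite combination of scalar exponential series. Both exponents in the theorem, those
  with \<open>H\<close> and with \<open>D h\<close>, are of this kind.\<close>

lemma mexp_conjugate_diagm:
  assumes "Q ** Q' = Finite_Cartesian_Product.mat 1" "Q' ** Q = Finite_Cartesian_Product.mat 1"
  shows "mexp (Q ** diagm a ** Q') = Q ** diagm (\<lambda>i. exp (a i)) ** Q'"
proof -
  let ?A = "Q ** diagm a ** Q'"
  have pow: "((\<lambda>B. ?A ** B) ^^ k) (Finite_Cartesian_Product.mat 1) = Q ** diagm (\<lambda>i. a i ^ k) ** Q'" for k
  proof (induction k)
    case 0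
    show ?case by (simp add: diagm_one assms)
  next
    case (Suc k)
    have "?A ** (Q ** diagm (\<lambda>i. a i ^ k) ** Q') = Q ** diagm a ** (Q' ** Q) ** diagm (\<lambda>i. a i ^ k) ** Q'"
      by (simp add: matrix_mul_assoc)
    also have "\<dots> = Q ** (diagm a ** diagm (\<lambda>i. a i ^ k)) ** Q'"
      by (simp add: assms matrix_mul_assoc)
    finally show ?case using Suc by (simp add: diagm_mult_diagm)
  qed
  have nth: "(Q ** diagm c ** Q') $ i $ j = (\<Sum>l\<in>UNIV. Q $ i $ l * c l * Q' $ l $ j)" for c i j
    by (subst matrix_matrix_mult_def) (simp add: mult_diagm_nth)
  have "(\<lambda>k. (1 / fact k) *\<^sub>R ((\<lambda>B. ?A ** B) ^^ k) (Finite_Cartesian_Product.mat 1))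
      sums (Q ** diagm (\<lambda>i. exp (a i)) ** Q')"
    unfolding pow sums_def
  proof (intro vec_tendstoI)
    fix i j
    have "(\<lambda>k. a l ^ k /\<^sub>R fact k) sums exp (a l)" for l by (rule exp_converges)
    then have "(\<lambda>k. \<Sum>l\<in>UNIV. Q $ i $ l * (a l ^ k /\<^sub>R fact k) * Q' $ l $ j) sums
        (\<Sum>l\<in>UNIV. Q $ i $ l * exp (a l) * Q' $ l $ j)"
      by (intro sums_sum sums_mult sums_mult2)
    then show "(\<lambda>n. (\<Sum>k<n. (1 / fact k) *\<^sub>R (Q ** diagm (\<lambda>i. a i ^ k) ** Q')) $ i $ j) \<longlonglongrightarrow>
        (Q ** diagm (\<lambda>i. exp (a i)) ** Q') $ i $ j"
      unfolding sums_def sum_component nth vector_scaleR_component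
      by (simp add: nth scaleR_sum_right inverse_eq_divide)
  qed
  then show ?thesis unfolding mexp_def by (rule sums_unique[symmetric])
qed

section \<open>Eigenspaces and spectral projectors in coordinates\<close>

lemma matrix_vector_mult_sum: "A *v (\<Sum>i\<in>I. f i) = (\<Sum>i\<in>I. A *v (f i :: 'a::semiring_1^'n))"
  by (induction I rule: infinite_finite_induct) (simp_all add: matrix_vector_right_distrib)

text \<open>Every \<open>x\<close> splits into \<open>P *v x\<close> in the common range and a
  remainder in the common kernel; \<open>Q\<close> fixes the former and kills the latter. This is
  the uniqueness behind the definite description in \<open>projector_along\<close>.\<close>

lemma idempotent_matrix_eqI:
  fixes P Q :: "'a::field^'n^'n"
  assumes P: "P ** P = P" and Q: "Q ** Q = Q"
    and range: "range ((*v) P) = range ((*v) Q)" and ker: "{v. P *v v = 0} = {v. Q *v v = 0}"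
  shows "P = Q"
proof -
  have "P *v x = Q *v x" for x
  proof -
    have "P *v (x - P *v x) = 0" by (simp add: matrix_vector_mult_diff_distrib matrix_vector_mul_assoc P)
    then have "Q *v (x - P *v x) = 0" using ker by blast
    then have "Q *v x = Q *v (P *v x)" by (simp add: matrix_vector_mult_diff_distrib)
    moreover obtain y where "P *v x = Q *v y" using range by blast
    ultimately show ?thesis by (simp add: matrix_vector_mul_assoc Q)
  qed
  then show ?thesis by (simp add: matrix_eq)
qed

text \<open>Fixing an explicit diagonalization turns eigenspaces, spectrum and projectors into
  conditions on the coordinates \<open>Q' *v v\<close>. It is interpreted twice: for the complex
  eigenbasis granted by hypothesis, and later for the complexified real one.\<close>

locale diagonalized =
  fixes H Q Q' :: "'a::field^'n^'n" and d :: "'n \<Rightarrow> 'a"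
  assumes QQ': "Q ** Q' = Finite_Cartesian_Product.mat 1" and Q'Q: "Q' ** Q = Finite_Cartesian_Product.mat 1"
    and H: "H = Q ** diagm d ** Q'"
begin

definition ind :: "'a \<Rightarrow> 'a^'n^'n" where
  "ind \<omega> = diagm (\<lambda>i. if d i = \<omega> then 1 else 0)"

lemma Q'Q_vec: "Q' *v (Q *v x) = x" and QQ'_vec: "Q *v (Q' *v x) = x"
  by (simp_all add: matrix_vector_mul_assoc QQ' Q'Q)

lemma conj_mult: "Q ** A ** Q' ** (Q ** B ** Q') = Q ** (A ** B) ** Q'"
proof -
  have "Q ** A ** Q' ** (Q ** B ** Q') = Q ** A ** (Q' ** Q) ** B ** Q'" by (simp add: matrix_mul_assoc)
  then show ?thesis by (simp add: Q'Q matrix_mul_assoc)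
qed

lemma shift_eq: "H - Finite_Cartesian_Product.mat \<omega> = Q ** diagm (\<lambda>i. d i - \<omega>) ** Q'"
proof -
  have "diagm (\<lambda>i. d i - \<omega>) = diagm d - diagm (\<lambda>_. \<omega>)" by (simp add: vec_eq_iff diagm_nth)
  moreover have "Q ** diagm (\<lambda>_. \<omega>) = diagm (\<lambda>_. \<omega>) ** Q"
    by (simp add: vec_eq_iff mult_diagm_nth diagm_mult_nth mult.commute)
  moreover have "diagm (\<lambda>_. \<omega>) = (Finite_Cartesian_Product.mat \<omega> :: 'a^'n^'n)"
    by (simp add: vec_eq_iff diagm_nth Finite_Cartesian_Product.mat_def)
  moreover have "diagm (\<lambda>_. \<omega>) ** Q ** Q' = diagm (\<lambda>_. \<omega>)"
    by (simp add: QQ' flip: matrix_mul_assoc)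
  moreover have "Q ** (diagm d - diagm (\<lambda>_. \<omega>)) ** Q' = Q ** diagm d ** Q' - Q ** diagm (\<lambda>_. \<omega>) ** Q'"
    by (simp add: vec_eq_iff matrix_matrix_mult_def algebra_simps sum_subtractf)
  ultimately show ?thesis by (simp add: H)
qed

lemma eigenspace_eq: "eigenspace H \<omega> = {v. \<forall>i. d i \<noteq> \<omega> \<longrightarrow> (Q' *v v) $ i = 0}"
proof -
  have "(H - Finite_Cartesian_Product.mat \<omega>) *v v = Q *v (diagm (\<lambda>i. d i - \<omega>) *v (Q' *v v))" for v
    by (simp add: shift_eq matrix_vector_mul_assoc matrix_mul_assoc)
  moreover have "Q *v x = 0 \<longleftrightarrow> x = 0" for x using Q'Q_vec[of x] by auto
  ultimately show ?thesis unfolding eigenspace_def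
    by (auto simp: vec_eq_iff diagm_vector_nth)
qed

lemma column_in_eigenspace: "Q *v axis i 1 \<in> eigenspace H (d i)"
  by (simp add: eigenspace_eq Q'Q_vec axis_def)

lemma column_nonzero: "Q *v axis i 1 \<noteq> 0"
proof -
  have "Q' *v (Q *v axis i 1) \<noteq> 0" by (simp add: Q'Q_vec axis_eq_0_iff)
  then show ?thesis by auto
qed

lemma mem_eigenspace_iff: "v \<in> eigenspace H \<omega> \<longleftrightarrow> H *v v = \<omega> *s v"
proof -
  have "Finite_Cartesian_Product.mat \<omega> *v v = \<omega> *s v"
    by (simp add: vec_eq_iff matrix_vector_mult_def Finite_Cartesian_Product.mat_def if_distrib if_distribR
        sum.delta' cong: if_cong)
  then show ?thesis by (simp add: eigenspace_def matrix_vector_mult_diff_rdistrib)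
qed

lemma spectrum_eq: "spectrum H = range d"
proof (intro equalityI subsetI)
  fix \<omega> assume "\<omega> \<in> spectrum H"
  then obtain v where v: "v \<noteq> 0" "v \<in> eigenspace H \<omega>" by (auto simp: spectrum_def mem_eigenspace_iff)
  then have "Q' *v v \<noteq> 0" using QQ'_vec[of v] by auto
  then show "\<omega> \<in> range d" using v(2) by (auto simp: eigenspace_eq vec_eq_iff)
next
  fix \<omega> assume "\<omega> \<in> range d"
  then show "\<omega> \<in> spectrum H"
    using column_in_eigenspace column_nonzero by (auto simp: spectrum_def mem_eigenspace_iff)
qed

lemma vector_expansion: "v = (\<Sum>i\<in>UNIV. (Q' *v v) $ i *s (Q *v axis i 1))"
proof -
  have "v = Q *v (\<Sum>i\<in>UNIV. (Q' *v v) $ i *s axis i 1)" by (simp add: basis_expansion QQ'_vec)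
  then show ?thesis
    by (simp add: matrix_vector_mult_sum vector_scalar_commute)
qed

lemma other_eigenspaces_span:
  "vec.span (\<Union>\<omega>'\<in>spectrum H - {\<omega>}. eigenspace H \<omega>') = {v. \<forall>i. d i = \<omega> \<longrightarrow> (Q' *v v) $ i = 0}"
    (is "vec.span ?E = ?W")
proof (intro equalityI subsetI)
  have "vec.subspace ?W"
    by (auto simp: vec.subspace_def matrix_vector_right_distrib vector_scalar_commute)
  moreover have "?E \<subseteq> ?W" by (auto simp: eigenspace_eq)
  ultimately show "v \<in> ?W" if "v \<in> vec.span ?E" for v using vec.span_minimal that by blast
next
  fix v assume v: "v \<in> ?W"
  have "(Q' *v v) $ i *s (Q *v axis i 1) \<in> vec.span ?E" for i
  proof (cases "d i = \<omega>")
    case True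
    then show ?thesis using v by (simp add: vec.span_zero)
  next
    case False
    then have "Q *v axis i 1 \<in> ?E" using column_in_eigenspace[of i] spectrum_eq by blast
    then show ?thesis by (intro vec.span_scale vec.span_base)
  qed
  then show "v \<in> vec.span ?E" by (subst vector_expansion) (intro vec.span_sum)
qed

lemma spectral_projector_eq: "spectral_projector H \<omega> = Q ** ind \<omega> ** Q'"
proof -
  let ?P = "Q ** ind \<omega> ** Q'"
  have ap: "?P *v v = Q *v (ind \<omega> *v (Q' *v v))" for v
    by (simp add: matrix_vector_mul_assoc matrix_mul_assoc)
  have idem: "?P ** ?P = ?P"
    unfolding conj_mult by (simp add: ind_def diagm_mult_diagm if_distrib cong: if_cong)
  have fixes_eig: "?P *v v = v" if "v \<in> eigenspace H \<omega>" for v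
  proof -
    have "ind \<omega> *v (Q' *v v) = Q' *v v"
      using that by (auto simp: vec_eq_iff ind_def diagm_vector_nth eigenspace_eq)
    then show ?thesis by (simp add: ap QQ'_vec)
  qed
  have "?P *v v \<in> eigenspace H \<omega>" for v
    unfolding ap eigenspace_eq by (simp add: Q'Q_vec ind_def diagm_vector_nth)
  then have range: "range ((*v) ?P) = eigenspace H \<omega>"
    using fixes_eig[symmetric] by (intro equalityI subsetI) (auto intro: rangeI image_eqI)
  have Q0: "Q *v x = 0 \<longleftrightarrow> x = 0" for x using Q'Q_vec[of x] by auto
  have "?P *v v = 0 \<longleftrightarrow> (\<forall>i. d i = \<omega> \<longrightarrow> (Q' *v v) $ i = 0)" for v
    unfolding ap Q0 by (auto simp: vec_eq_iff ind_def diagm_vector_nth)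
  then have ker: "{v. ?P *v v = 0} = {v. \<forall>i. d i = \<omega> \<longrightarrow> (Q' *v v) $ i = 0}" by simp
  show ?thesis
    unfolding spectral_projector_def projector_along_def other_eigenspaces_span
  proof (rule the_equality)
    fix P assume "P ** P = P \<and> range ((*v) P) = eigenspace H \<omega> \<and>
        {v. P *v v = 0} = {v. \<forall>i. d i = \<omega> \<longrightarrow> (Q' *v v) $ i = 0}"
    then have P: "P ** P = P" "range ((*v) P) = eigenspace H \<omega>"
      "{v. P *v v = 0} = {v. \<forall>i. d i = \<omega> \<longrightarrow> (Q' *v v) $ i = 0}" by blast+
    show "P = ?P"
      by (rule idempotent_matrix_eqI[OF P(1) idem trans[OF P(2) range[symmetric]]
            trans[OF P(3) ker[symmetric]]])
  qed (intro conjI idem range ker)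
qed

text \<open>This count lets the simple eigenvalues on an eigenspace be matched one to one with the
  indices \<open>i\<close> belonging to it.\<close>

lemma dim_eigenspace: "vec.dim (eigenspace H \<omega>) = card {i. d i = \<omega>}"
proof -
  let ?c = "\<lambda>i. Q *v axis i 1"
  let ?B = "?c ` {i. d i = \<omega>}"
  have inj: "inj ?c"
  proof (rule injI)
    fix i j assume "?c i = ?c j"
    then have "Q' *v ?c i = Q' *v ?c j" by simp
    then show "i = j" by (simp add: Q'Q_vec axis_eq_axis)
  qed
  have "?B \<subseteq> eigenspace H \<omega>" using column_in_eigenspace by auto
  moreover have "vec.independent ?B"
  proof (rule vec.independent_if_scalars_zero)
    fix f x assume s: "(\<Sum>x\<in>?B. f x *s x) = 0" and x: "x \<in> ?B"
    then obtain k where k: "x = ?c k" "d k = \<omega>" by auto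
    have "(\<Sum>x\<in>?B. f x *s x) = (\<Sum>i | d i = \<omega>. f (?c i) *s ?c i)"
      by (rule sum.reindex_cong[of ?c]) (use inj in \<open>auto intro: inj_on_subset\<close>)
    then have "Q' *v (\<Sum>i | d i = \<omega>. f (?c i) *s ?c i) = 0" using s by simp
    then have "(\<Sum>i | d i = \<omega>. f (?c i) *s axis i 1) = 0"
      by (simp add: matrix_vector_mult_sum vector_scalar_commute Q'Q_vec)
    then have "(\<Sum>i | d i = \<omega>. f (?c i) *s axis i 1) $ k = 0" by simp
    then show "f x = 0" using k
      by (simp add: axis_def if_distrib sum.delta cong: if_cong)
  qed simp
  moreover have "eigenspace H \<omega> \<subseteq> vec.span ?B"
  proof
    fix v assume v: "v \<in> eigenspace H \<omega>"
    have "(Q' *v v) $ i *s ?c i \<in> vec.span ?B" for i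
      using v by (cases "d i = \<omega>") (auto simp: eigenspace_eq vec.span_zero intro: vec.span_scale vec.span_base)
    then show "v \<in> vec.span ?B" by (subst vector_expansion) (intro vec.span_sum)
  qed
  ultimately have "vec.dim (eigenspace H \<omega>) = card ?B"
    by (intro vec.basis_card_eq_dim[symmetric])
  then show ?thesis using inj by (simp add: card_image inj_on_subset)
qed

end

section \<open>Real eigenbases\<close>

text \<open>The characteristic polynomial has degree \<open>vec.dim V\<close> and, by hypothesis,
  only simple roots. Over the complex numbers such a polynomial has as many distinct roots as its
  degree, and every root is an eigenvalue on \<open>V\<close>.\<close>

lemma endo_eigenvalues_card:
  fixes V :: "(complex^'n) set" and A :: "complex^'n^'n"
  defines "f \<equiv> (*v) A"
  assumes V: "vec.subspace V" and fV: "\<And>v. v \<in> V \<Longrightarrow> f v \<in> V"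
    and simple: "\<And>\<mu>. endo_eigenvalue V f \<mu> \<Longrightarrow> endo_simple_eigenvalue V f \<mu>"
  obtains M where "finite M" "card M = vec.dim V" "\<And>\<mu>. \<mu> \<in> M \<Longrightarrow> endo_eigenvalue V f \<mu>"
proof -
  \<comment> \<open>The same arbitrary choice as in \<open>endo_char_poly\<close>, so that the
    multiplicities in the hypothesis are those of the matrix \<open>E\<close> below.\<close>
  define bs where "bs = (SOME bs. basis_list V bs)"
  have "\<exists>bs. basis_list V bs"
  proof -
    obtain B where B: "B \<subseteq> V" "vec.independent B" "V \<subseteq> vec.span B" "card B = vec.dim V"
      by (rule vec.basis_exists)
    obtain xs where "set xs = B" "distinct xs"
      using finite_distinct_list[OF vec.finiteI_independent[OF B(2)]] by blast
    moreover have "vec.span B = V" using B V by (simp add: subset_antisym vec.span_minimal)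
    ultimately show ?thesis using B by (auto simp: basis_list_def)
  qed
  then have "basis_list V bs" unfolding bs_def by (rule someI_ex)
  then have bs: "distinct bs" "vec.independent (set bs)" "vec.span (set bs) = V"
    by (auto simp: basis_list_def)
  define m where "m = length bs"
  have m: "m = vec.dim V"
    using vec.dim_eq_card_independent[OF bs(2)] vec.dim_span[of "set bs"] bs(1,3)
    by (simp add: m_def distinct_card)
  define E where "E = endo_matrix bs f"
  have E: "E \<in> carrier_mat m m" by (simp add: E_def endo_matrix_def m_def)
  have reindex: "(\<Sum>b\<in>set bs. g b) = (\<Sum>i<m. g (bs ! i))" for g :: "complex^'n \<Rightarrow> complex^'n"
    using sum.reindex_bij_betw[OF bij_betw_nth[OF bs(1), of "{..<m}" "set bs"], of g]
    by (simp add: m_def)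
  have f_bs: "f (bs ! j) = (\<Sum>i<m. (E $$ (i, j)) *s (bs ! i))" if j: "j < m" for j
  proof -
    have "bs ! j \<in> V" using j bs(3) vec.span_base[of "bs ! j" "set bs"] by (auto simp: m_def)
    then have "f (bs ! j) \<in> vec.span (set bs)" using fV bs(3) by simp
    then have "(\<Sum>b\<in>set bs. vec.representation (set bs) (f (bs ! j)) b *s b) = f (bs ! j)"
      using vec.sum_representation_eq[OF bs(2)] by simp
    then show ?thesis using j unfolding reindex by (simp add: E_def endo_matrix_def m_def)
  qed
  have root_eigenvalue: "endo_eigenvalue V f \<mu>" if "poly (char_poly E) \<mu> = 0" for \<mu>
  proof -
    have "eigenvalue E \<mu>" using eigenvalue_root_char_poly[OF E] that by simp
    then obtain x where x: "x \<in> carrier_vec m" "x \<noteq> 0\<^sub>v m" "E *\<^sub>v x = \<mu> \<cdot>\<^sub>v x"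
      using E by (auto simp: eigenvalue_def eigenvector_def)
    define v where "v = (\<Sum>i<m. vec_index x i *s (bs ! i))"
    have Ex: "(\<Sum>j<m. E $$ (i, j) * vec_index x j) = \<mu> * vec_index x i" if "i < m" for i
    proof -
      have "vec_index (E *\<^sub>v x) i = (\<Sum>j<m. E $$ (i, j) * vec_index x j)"
        using that E x(1) by (auto simp: scalar_prod_def atLeast0LessThan)
      then show ?thesis using that x by simp
    qed
    have "f v = (\<Sum>j<m. vec_index x j *s f (bs ! j))"
      unfolding v_def f_def by (simp add: matrix_vector_mult_sum vector_scalar_commute)
    also have "\<dots> = (\<Sum>j<m. \<Sum>i<m. (E $$ (i, j) * vec_index x j) *s (bs ! i))"
      by (intro sum.cong refl) (simp add: f_bs vec.scale_sum_right mult.commute)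
    also have "\<dots> = (\<Sum>i<m. (\<Sum>j<m. E $$ (i, j) * vec_index x j) *s (bs ! i))"
      by (subst sum.swap) (simp add: vec.scale_sum_left)
    also have "\<dots> = \<mu> *s v" unfolding v_def vec.scale_sum_right
      by (intro sum.cong refl) (simp add: Ex)
    finally have "f v = \<mu> *s v" .
    moreover have "v \<in> V"
    proof -
      have "bs ! i \<in> vec.span (set bs)" if "i < m" for i using that by (auto simp: m_def intro: vec.span_base)
      then have "v \<in> vec.span (set bs)" unfolding v_def by (intro vec.span_sum vec.span_scale) auto
      then show ?thesis using bs(3) by simp
    qed
    moreover have "v \<noteq> 0"
    proof
      assume v0: "v = 0"
      \<comment> \<open>Independence speaks of coefficients attached to vectors, whereas
        \<open>x\<close> is indexed by positions; distinctness of the list makes the transfer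
        possible.\<close>
      define u where "u b = vec_index x (the_inv_into {..<m} ((!) bs) b)" for b
      have inj: "inj_on ((!) bs) {..<m}" using bs(1) by (auto simp: inj_on_def m_def nth_eq_iff_index_eq)
      have u: "u (bs ! i) = vec_index x i" if "i < m" for i
        using that by (simp add: u_def the_inv_into_f_f[OF inj])
      have s0: "(\<Sum>b\<in>set bs. u b *s b) = 0" unfolding reindex using v0 by (simp add: u v_def)
      have "u (bs ! i) = 0" if "i < m" for i
        using vec.independentD[OF bs(2) finite_set subset_refl s0] that by (simp add: m_def)
      then have "x = 0\<^sub>v m" using x(1) u by (intro eq_vecI) auto
      then show False using x by simp
    qed
    ultimately show ?thesis by (auto simp: endo_eigenvalue_def)
  qed
  define M where "M = {\<mu>. poly (char_poly E) \<mu> = 0}"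
  have cp: "degree (char_poly E) = m" "char_poly E \<noteq> 0"
    using degree_monic_char_poly[OF E] by auto
  have "rsquarefree (char_poly E)"
    unfolding rsquarefree_def
  proof (intro conjI allI cp)
    fix \<mu>
    show "Polynomial.order \<mu> (char_poly E) = 0 \<or> Polynomial.order \<mu> (char_poly E) = 1"
    proof (cases "poly (char_poly E) \<mu> = 0")
      case True
      then show ?thesis using simple[OF root_eigenvalue]
        by (simp add: endo_simple_eigenvalue_def endo_char_poly_def E_def bs_def)
    qed (simp add: order_0I)
  qed
  then have "card M = m" using rsquarefree_card_degree[OF cp(2)] cp(1) by (simp add: M_def)
  moreover have "finite M" unfolding M_def using cp(2) by (rule poly_roots_finite)
  ultimately show thesis using that m root_eigenvalue by (auto simp: M_def)
qed

context diagonalized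
begin

lemma projector_in_eigenspace: "spectral_projector H \<omega> *v v \<in> eigenspace H \<omega>"
proof -
  have "spectral_projector H \<omega> *v v = Q *v (ind \<omega> *v (Q' *v v))"
    by (simp add: spectral_projector_eq matrix_vector_mul_assoc matrix_mul_assoc)
  then show ?thesis by (simp add: eigenspace_eq Q'Q_vec) (simp add: ind_def diagm_vector_nth)
qed

lemma projector_eigenvector:
  assumes "v \<in> eigenspace H \<omega>"
  shows "spectral_projector H \<omega>' *v v = (if \<omega>' = \<omega> then v else 0)"
proof -
  have "spectral_projector H \<omega>' *v v = Q *v (ind \<omega>' *v (Q' *v v))"
    by (simp add: spectral_projector_eq matrix_vector_mul_assoc matrix_mul_assoc)
  also have "ind \<omega>' *v (Q' *v v) = (if \<omega>' = \<omega> then Q' *v v else 0)"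
    using assms by (auto simp: vec_eq_iff ind_def diagm_vector_nth eigenspace_eq)
  finally show ?thesis by (simp add: QQ'_vec)
qed

lemma projector_mult_shift: "spectral_projector H \<omega> ** (H - Finite_Cartesian_Product.mat \<omega>) = 0"
proof -
  have "ind \<omega> ** diagm (\<lambda>i. d i - \<omega>) = 0"
    by (simp add: vec_eq_iff mult_diagm_nth) (simp add: ind_def diagm_nth)
  then show ?thesis unfolding spectral_projector_eq shift_eq conj_mult by simp
qed

text \<open>The kernel of the projector is the range of the shifted matrix. Thus an eigenvalue
  equation for the projected operator says that \<open>R - mat \<mu>\<close> maps \<open>v\<close>
  into the range of \<open>H - mat \<omega>\<close>: a condition free of projectors, which can be
  split into real and imaginary parts.\<close>

lemma projector_complement:
  "\<exists>Z. v - spectral_projector H \<omega> *v v = (H - Finite_Cartesian_Product.mat \<omega>) *v (Z *v v)"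
proof -
  \<comment> \<open>A pseudo-inverse of the shift: since \<open>inverse 0 = 0\<close>, it inverts on
    the other eigenspaces and vanishes on this one.\<close>
  let ?Z = "Q ** diagm (\<lambda>i. inverse (d i - \<omega>)) ** Q'"
  have "(H - Finite_Cartesian_Product.mat \<omega>) *v (?Z *v v)
      = Q *v ((diagm (\<lambda>i. d i - \<omega>) ** diagm (\<lambda>i. inverse (d i - \<omega>))) *v (Q' *v v))"
    unfolding shift_eq matrix_vector_mul_assoc conj_mult by (simp add: matrix_mul_assoc)
  also have "diagm (\<lambda>i. d i - \<omega>) ** diagm (\<lambda>i. inverse (d i - \<omega>)) = Finite_Cartesian_Product.mat 1 - ind \<omega>"
    by (simp add: diagm_mult_diagm vec_eq_iff diagm_nth ind_def Finite_Cartesian_Product.mat_def)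
  also have "Q *v ((Finite_Cartesian_Product.mat 1 - ind \<omega>) *v (Q' *v v)) = v - spectral_projector H \<omega> *v v"
    by (simp add: spectral_projector_eq matrix_vector_mult_diff_rdistrib matrix_vector_mult_diff_distrib
        QQ'_vec) (simp add: matrix_vector_mul_assoc matrix_mul_assoc)
  finally show ?thesis by (intro exI[of _ ?Z]) simp
qed

end

text \<open>A nonzero kernel vector of minimal support would have to be a multiple of a unit vector,
  as the kernel is invariant under both diagonal matrices.\<close>
lemma joint_eigenvectors_invertible:
  fixes P A B :: "'a::field^'n^'n"
  assumes A: "A ** P = P ** diagm a" and B: "B ** P = P ** diagm b"
    and distinct: "\<And>i j. i \<noteq> j \<Longrightarrow> a i \<noteq> a j \<or> b i \<noteq> b j"
    and nonzero: "\<And>i. P *v axis i 1 \<noteq> 0"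
  shows "invertible P"
proof -
  have invariant: "P *v (diagm e *v c - t *s c) = 0"
    if "C ** P = P ** diagm e" "P *v c = 0" for C e c t
  proof -
    have "P *v (diagm e *v c) = C *v (P *v c)" by (simp add: matrix_vector_mul_assoc that(1))
    then show ?thesis using that(2) by (simp add: matrix_vector_mult_diff_distrib vector_scalar_commute)
  qed
  have "c = 0" if "P *v c = 0" for c
  proof (rule ccontr)
    assume "c \<noteq> 0"
    define supp where "supp c = {i. c $ i \<noteq> 0}" for c :: "'a^'n"
    from that \<open>c \<noteq> 0\<close> have "\<exists>c. P *v c = 0 \<and> c \<noteq> 0" by blast
    then obtain c where c: "P *v c = 0" "c \<noteq> 0"
      and minimal: "\<And>c'. P *v c' = 0 \<Longrightarrow> c' \<noteq> 0 \<Longrightarrow> card (supp c) \<le> card (supp c')"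
      using ex_has_least_nat[of "\<lambda>c. P *v c = 0 \<and> c \<noteq> 0" _ "\<lambda>c. card (supp c)"] by blast
    obtain k where k: "c $ k \<noteq> 0" using c(2) by (auto simp: vec_eq_iff)
    have no_split: "e j = e k" if "c $ j \<noteq> 0" "C ** P = P ** diagm e" for C e j
    proof (rule ccontr)
      assume ne: "e j \<noteq> e k"
      \<comment> \<open>This kernel vector keeps coordinate \<open>j\<close> but loses coordinate
        \<open>k\<close>, so its support is strictly smaller than the minimal one.\<close>
      let ?c = "diagm e *v c - e k *s c"
      have nth: "?c $ i = (e i - e k) * c $ i" for i by (simp add: diagm_vector_nth algebra_simps)
      have "?c $ j \<noteq> 0" using ne that(1) unfolding nth by simp
      then have "?c \<noteq> 0" by (metis zero_index)
      moreover have "supp ?c = {i. (e i - e k) * c $ i \<noteq> 0}" unfolding supp_def nth ..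
      then have "supp ?c \<subset> supp c" using k by (auto simp: supp_def)
      then have "card (supp ?c) < card (supp c)" by (simp add: psubset_card_mono)
      ultimately show False using minimal[OF invariant[OF that(2) c(1), of "e k"]] by simp
    qed
    have "c $ j = 0" if "j \<noteq> k" for j using no_split[OF _ A] no_split[OF _ B] distinct[OF that] by blast
    then have "c = c $ k *s axis k 1" by (auto simp: vec_eq_iff axis_def)
    then have "c $ k *s (P *v axis k 1) = 0" using c(1) by (metis vector_scalar_commute)
    then show False using k nonzero[of k] by simp
  qed
  then show ?thesis
    using matrix_left_invertible_ker[of P] invertible_left_inverse[of P] by blast
qed

lemma Re_cmat_vector: "Re ((cmat A *v x) $ i) = (A *v (\<chi> j. Re (x $ j))) $ i"
  and Im_cmat_vector: "Im ((cmat A *v x) $ i) = (A *v (\<chi> j. Im (x $ j))) $ i"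
  by (simp_all add: matrix_vector_mult_def)

text \<open>Real matrices act separately on the real and imaginary parts of \<open>u\<close> and
  \<open>w\<close>, and at least one part of \<open>u\<close> is nonzero.\<close>

lemma real_solution:
  fixes A C D :: "real^'n^'n"
  assumes "cmat A *v u = 0" "u \<noteq> 0" "cmat C *v u = cmat D *v w"
  obtains v w' where "v \<noteq> 0" "A *v v = 0" "C *v v = D *v w'"
proof -
  let ?r = "\<lambda>x :: complex^'n. (\<chi> j. Re (x $ j))" and ?i = "\<lambda>x :: complex^'n. (\<chi> j. Im (x $ j))"
  have *: "A *v ?r u = 0" "A *v ?i u = 0" "C *v ?r u = D *v ?r w" "C *v ?i u = D *v ?i w"
    using assms by (simp_all add: vec_eq_iff flip: Re_cmat_vector Im_cmat_vector)
  have "?r u \<noteq> 0 \<or> ?i u \<noteq> 0" using assms(2) by (auto simp: vec_eq_iff complex_eq_iff)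
  then show thesis using that * by blast
qed

lemma mat_vector_mult: "Finite_Cartesian_Product.mat t *v x = (t :: 'a::semiring_1) *s x"
  by (simp add: vec_eq_iff matrix_vector_mult_def Finite_Cartesian_Product.mat_def if_distrib if_distribR
      sum.delta' cong: if_cong)

lemma cmat_shift: "cmat (A - Finite_Cartesian_Product.mat t) = cmat A - Finite_Cartesian_Product.mat (of_real t)"
  by (simp add: vec_eq_iff Finite_Cartesian_Product.mat_def)

text \<open>The columns of \<open>P\<close> are common eigenvectors of \<open>H\<close> and of the
  sum of the projected \<open>R\<close>, labelled by distinct pairs of eigenvalues. The conclusion
  about \<open>R\<close> concerns only positions inside one eigenspace of \<open>H\<close>; the
  other entries are unrestricted.\<close>

lemma real_adapted_basis:
  fixes H R :: "real^'n^'n"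
  assumes H_diag: "diagonalizable (cmat H)"
    and H_real: "spectrum (cmat H) \<subseteq> \<real>"
    and simple:
      "\<And>\<omega> \<mu>. \<omega> \<in> spectrum (cmat H) \<Longrightarrow>
         endo_eigenvalue (eigenspace (cmat H) \<omega>)
           (\<lambda>v. spectral_projector (cmat H) \<omega> *v (cmat R *v v)) \<mu> \<Longrightarrow>
         \<mu> \<in> \<real> \<and>
         endo_simple_eigenvalue (eigenspace (cmat H) \<omega>)
           (\<lambda>v. spectral_projector (cmat H) \<omega> *v (cmat R *v v)) \<mu>"
  obtains P P' :: "real^'n^'n" and d \<mu> :: "'n \<Rightarrow> real"
  where "P ** P' = Finite_Cartesian_Product.mat 1" "P' ** P = Finite_Cartesian_Product.mat 1"
    "H = P ** diagm d ** P'" "\<And>i j. i \<noteq> j \<Longrightarrow> d i = d j \<Longrightarrow> \<mu> i \<noteq> \<mu> j"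
    "\<And>i j. d i = d j \<Longrightarrow> (P' ** R ** P) $ i $ j = (if i = j then \<mu> j else 0)"
proof -
  obtain Q :: "complex^'n^'n" where Q: "invertible Q" "diagonal (matrix_inv Q ** cmat H ** Q)"
    using H_diag by (auto simp: diagonalizable_def)
  define dc where "dc i = (matrix_inv Q ** cmat H ** Q) $ i $ i" for i
  have "matrix_inv Q ** cmat H ** Q = diagm dc"
    using diagonal_imp_diagm[OF Q(2)] by (simp flip: dc_def)
  then have "Q ** diagm dc ** matrix_inv Q = Q ** (matrix_inv Q ** cmat H ** Q) ** matrix_inv Q" by simp
  also have "\<dots> = (Q ** matrix_inv Q) ** cmat H ** (Q ** matrix_inv Q)" by (simp add: matrix_mul_assoc)
  finally interpret diagonalized "cmat H" Q "matrix_inv Q" dc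
    using matrix_inv_right_left[OF Q(1)] by unfold_locales simp_all
  let ?E = "eigenspace (cmat H)" and ?Pi = "spectral_projector (cmat H)"
  define d where "d i = Re (dc i)" for i
  have "dc i \<in> \<real>" for i using H_real spectrum_eq by blast
  then have dc: "dc i = of_real (d i)" for i by (simp add: d_def)
  have "\<exists>M. finite M \<and> card M = card {i. dc i = \<omega>} \<and>
      (\<forall>\<mu>\<in>M. endo_eigenvalue (?E \<omega>) ((*v) (?Pi \<omega> ** cmat R)) \<mu>)" if "\<omega> \<in> range dc" for \<omega>
  proof -
    have f: "(\<lambda>v. ?Pi \<omega> *v (cmat R *v v)) = (*v) (?Pi \<omega> ** cmat R)"
      by (simp add: fun_eq_iff matrix_vector_mul_assoc)
    have sub: "vec.subspace (?E \<omega>)"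
      by (auto simp: vec.subspace_def eigenspace_eq matrix_vector_right_distrib vector_scalar_commute)
    have maps: "(?Pi \<omega> ** cmat R) *v v \<in> ?E \<omega>" for v
      using projector_in_eigenspace[of \<omega> "cmat R *v v"] by (simp add: matrix_vector_mul_assoc)
    have "\<omega> \<in> spectrum (cmat H)" using that by (simp add: spectrum_eq)
    note simple_ev = simple[OF this, unfolded f, THEN conjunct2]
    show ?thesis
      by (rule endo_eigenvalues_card[OF sub maps simple_ev]) (auto simp: dim_eigenspace)
  qed
  then have "\<forall>\<omega>\<in>range dc. \<exists>M. finite M \<and> card M = card {i. dc i = \<omega>} \<and>
      (\<forall>\<mu>\<in>M. endo_eigenvalue (?E \<omega>) ((*v) (?Pi \<omega> ** cmat R)) \<mu>)" by blast
  from bchoice[OF this] obtain M where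
    M: "\<And>\<omega>. \<omega> \<in> range dc \<Longrightarrow> finite (M \<omega>) \<and> card (M \<omega>) = card {i. dc i = \<omega>} \<and>
      (\<forall>\<mu>\<in>M \<omega>. endo_eigenvalue (?E \<omega>) ((*v) (?Pi \<omega> ** cmat R)) \<mu>)"
    by blast
  \<comment> \<open>An eigenspace has as many distinct eigenvalues as indices, so each index
    receives its own; injectivity of the matching yields the separation of the
    \<open>\<mu> i\<close>.\<close>
  have "\<exists>g. bij_betw g {i. dc i = \<omega>} (M \<omega>)" if "\<omega> \<in> range dc" for \<omega>
    using M[OF that] by (intro finite_same_card_bij) auto
  then have "\<forall>\<omega>\<in>range dc. \<exists>g. bij_betw g {i. dc i = \<omega>} (M \<omega>)" by blast
  from bchoice[OF this] obtain g where
    g: "\<And>\<omega>. \<omega> \<in> range dc \<Longrightarrow> bij_betw (g \<omega>) {i. dc i = \<omega>} (M \<omega>)"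
    by blast
  have ev: "endo_eigenvalue (?E (dc i)) (\<lambda>v. ?Pi (dc i) *v (cmat R *v v)) (g (dc i) i)" for i
    using M[of "dc i"] bij_betwE[OF g[of "dc i"]] by (simp add: matrix_vector_mul_assoc)
  define \<mu> where "\<mu> i = Re (g (dc i) i)" for i
  have "g (dc i) i \<in> \<real>" for i
    by (rule conjunct1[OF simple[OF _ ev[of i]]]) (simp add: spectrum_eq)
  then have \<mu>: "g (dc i) i = of_real (\<mu> i)" for i by (simp add: \<mu>_def)
  have distinct: "\<mu> i \<noteq> \<mu> j" if "i \<noteq> j" "d i = d j" for i j
  proof
    assume "\<mu> i = \<mu> j"
    then have "g (dc i) i = g (dc i) j" using \<mu>[of i] \<mu>[of j] that by (simp add: dc)
    then show False using bij_betw_imp_inj_on[OF g[of "dc i"]] that by (auto simp: inj_on_def dc)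
  qed
  have "\<exists>v w. v \<noteq> 0 \<and> (H - Finite_Cartesian_Product.mat (d i)) *v v = 0 \<and>
      (R - Finite_Cartesian_Product.mat (\<mu> i)) *v v = (H - Finite_Cartesian_Product.mat (d i)) *v w" for i
  proof -
    obtain u where u: "u \<in> ?E (dc i)" "u \<noteq> 0" "?Pi (dc i) *v (cmat R *v u) = of_real (\<mu> i) *s u"
      using ev[of i] by (auto simp: endo_eigenvalue_def \<mu>)
    obtain Z where Z: "cmat R *v u - ?Pi (dc i) *v (cmat R *v u)
        = (cmat H - Finite_Cartesian_Product.mat (dc i)) *v (Z *v (cmat R *v u))"
      using projector_complement by blast
    have Hu: "cmat (H - Finite_Cartesian_Product.mat (d i)) *v u = 0"
      using u(1) by (simp add: cmat_shift eigenspace_def flip: dc)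
    have Ru: "cmat (R - Finite_Cartesian_Product.mat (\<mu> i)) *v u
        = cmat (H - Finite_Cartesian_Product.mat (d i)) *v (Z *v (cmat R *v u))"
      using Z u(3) by (simp add: cmat_shift matrix_vector_mult_diff_rdistrib[of "cmat R"] mat_vector_mult flip: dc)
    show ?thesis by (rule real_solution[OF Hu u(2) Ru]) blast
  qed
  then have "\<forall>i. \<exists>v w. v \<noteq> 0 \<and> (H - Finite_Cartesian_Product.mat (d i)) *v v = 0 \<and>
      (R - Finite_Cartesian_Product.mat (\<mu> i)) *v v = (H - Finite_Cartesian_Product.mat (d i)) *v w" ..
  from choice[OF this] obtain v where "\<forall>i. \<exists>w. v i \<noteq> 0 \<and> (H - Finite_Cartesian_Product.mat (d i)) *v v i = 0 \<and>
      (R - Finite_Cartesian_Product.mat (\<mu> i)) *v v i = (H - Finite_Cartesian_Product.mat (d i)) *v w" ..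
  from choice[OF this] obtain w where v: "\<And>i. v i \<noteq> 0"
    and Hv0: "\<And>i. (H - Finite_Cartesian_Product.mat (d i)) *v v i = 0"
    and Rv: "\<And>i. (R - Finite_Cartesian_Product.mat (\<mu> i)) *v v i = (H - Finite_Cartesian_Product.mat (d i)) *v w i"
    by blast
  define P :: "real^'n^'n" where "P = (\<chi> a i. v i $ a)"
  have mult_P: "(A ** P) $ a $ i = (A *v v i) $ a" for A :: "real^'n^'n" and a i
    by (simp add: P_def matrix_matrix_mult_def matrix_vector_mult_def)
  have Hv: "H *v v i = d i *s v i" for i
    using Hv0[of i] by (simp add: matrix_vector_mult_diff_rdistrib mat_vector_mult)
  have HP: "H ** P = P ** diagm d"
    by (simp add: vec_eq_iff mult_P Hv mult_diagm_nth) (simp add: P_def mult.commute)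
  define cv where "cv i = (\<chi> a. complex_of_real (v i $ a))" for i
  have cmat_cv: "(cmat A *v cv i) $ a = of_real ((A *v v i) $ a)" for A :: "real^'n^'n" and i a
    by (simp add: cv_def matrix_vector_mult_def)
  have cP_mult: "(A ** cmat P) $ a $ i = (A *v cv i) $ a" for A a i
    by (simp add: P_def cv_def matrix_matrix_mult_def matrix_vector_mult_def)
  have cv_E: "cv i \<in> ?E (dc i)" for i
    unfolding eigenspace_def using Hv0[of i] cmat_cv[of "H - Finite_Cartesian_Product.mat (d i)" i]
    by (simp add: vec_eq_iff cmat_shift dc)
  have PiR: "?Pi (dc i) *v (cmat R *v cv i) = of_real (\<mu> i) *s cv i" for i
  proof -
    let ?w = "\<chi> a. complex_of_real (w i $ a)"
    have "cmat (R - Finite_Cartesian_Product.mat (\<mu> i)) *v cv i = cmat (H - Finite_Cartesian_Product.mat (d i)) *v ?w"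
      unfolding vec_eq_iff cmat_cv Rv by (simp add: matrix_vector_mult_def)
    then have "cmat R *v cv i = of_real (\<mu> i) *s cv i + (cmat H - Finite_Cartesian_Product.mat (dc i)) *v ?w"
      by (simp add: cmat_shift dc matrix_vector_mult_diff_rdistrib[of "cmat R"] mat_vector_mult algebra_simps)
    then have "?Pi (dc i) *v (cmat R *v cv i) = of_real (\<mu> i) *s (?Pi (dc i) *v cv i)
        + (?Pi (dc i) ** (cmat H - Finite_Cartesian_Product.mat (dc i))) *v ?w"
      by (simp add: matrix_vector_right_distrib vector_scalar_commute matrix_vector_mul_assoc)
    then show ?thesis using projector_eigenvector[OF cv_E] by (simp add: projector_mult_shift)
  qed
  \<comment> \<open>Individual eigenspaces do not separate all columns. This sum has every
    \<open>cv i\<close> as eigenvector with eigenvalue \<open>\<mu> i\<close>, so together with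
    \<open>H\<close> it distinguishes them and makes \<open>P\<close> invertible.\<close>
  define B where "B = (\<Sum>\<omega>\<in>range dc. ?Pi \<omega> ** cmat R ** ?Pi \<omega>)"
  have Bcv: "B *v cv i = of_real (\<mu> i) *s cv i" for i
  proof -
    have sum_mult: "(\<Sum>x\<in>I. F x) *v u = (\<Sum>x\<in>I. F x *v u)" for I :: "complex set"
      and F :: "complex \<Rightarrow> complex^'n^'n" and u
      by (induction I rule: infinite_finite_induct) (simp_all add: matrix_vector_mult_add_rdistrib)
    have "B *v cv i = (\<Sum>\<omega>\<in>range dc. ?Pi \<omega> *v (cmat R *v (?Pi \<omega> *v cv i)))"
      unfolding B_def sum_mult by (simp add: matrix_vector_mul_assoc matrix_mul_assoc)
    also have "\<dots> = (\<Sum>\<omega>\<in>range dc. if \<omega> = dc i then of_real (\<mu> i) *s cv i else 0)"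
      by (intro sum.cong refl) (simp add: projector_eigenvector[OF cv_E] PiR)
    finally show ?thesis by (simp add: sum.delta)
  qed
  have "invertible (cmat P)"
  proof (rule joint_eigenvectors_invertible)
    show "cmat H ** cmat P = cmat P ** diagm (\<lambda>i. of_real (d i))"
      using HP by (metis cmat_mult cmat_diagm)
    show "B ** cmat P = cmat P ** diagm (\<lambda>i. of_real (\<mu> i))"
      by (simp add: vec_eq_iff cP_mult Bcv mult_diagm_nth) (simp add: P_def cv_def mult.commute)
    show "complex_of_real (d i) \<noteq> of_real (d j) \<or> complex_of_real (\<mu> i) \<noteq> of_real (\<mu> j)" if "i \<noteq> j" for i j
      using distinct[OF that] by auto
    have "(cmat P *v axis i 1) $ a = of_real (v i $ a)" for i a
      by (simp add: P_def matrix_vector_mult_def axis_def if_distrib sum.delta cong: if_cong)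
    then show "cmat P *v axis i 1 \<noteq> 0" for i using v[of i] by (auto simp: vec_eq_iff)
  qed
  then have inv: "invertible P" by (simp add: invertible_cmat_iff)
  note PP' = matrix_inv_right_left[OF inv]
  let ?P' = "matrix_inv P"
  have H: "H = P ** diagm d ** ?P'"
  proof -
    have "P ** diagm d ** ?P' = H ** (P ** ?P')" by (simp add: HP matrix_mul_assoc)
    then show ?thesis using PP' by simp
  qed
  have P'v: "?P' *v v i = axis i 1" for i
  proof -
    have "v i = P *v axis i 1"
      by (simp add: vec_eq_iff P_def matrix_vector_mult_def axis_def if_distrib sum.delta cong: if_cong)
    then show ?thesis using PP' by (simp add: matrix_vector_mul_assoc)
  qed
  have "(?P' ** R ** P) $ i $ j = (if i = j then \<mu> j else 0)" if "d i = d j" for i j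
  proof -
    have Pm: "P' ** P = Finite_Cartesian_Product.mat 1 \<Longrightarrow> P' *v (H *v x) = diagm d *v (?P' *v x)"
      if "P' = ?P'" for P' x
      by (subst H) (simp add: that matrix_vector_mul_assoc matrix_mul_assoc PP')
    have "R *v v j = \<mu> j *s v j + (H *v w j - d j *s w j)"
      using Rv[of j] by (simp add: matrix_vector_mult_diff_rdistrib mat_vector_mult algebra_simps)
    \<comment> \<open>In position \<open>i\<close> the last bracket is \<open>d i - d j\<close>
      times a coordinate of \<open>w j\<close>, hence zero inside the eigenspace.\<close>
    then have "?P' *v (R *v v j) = \<mu> j *s axis j 1 + (diagm d *v (?P' *v w j) - d j *s (?P' *v w j))"
      using PP' by (simp add: matrix_vector_right_distrib matrix_vector_mult_diff_distrib vector_scalar_commute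
          P'v Pm)
    then have "(?P' *v (R *v v j)) $ i = \<mu> j * axis j 1 $ i"
      by (simp add: diagm_vector_nth that)
    then show ?thesis by (auto simp: mult_P matrix_vector_mul_assoc axis_def)
  qed
  then show thesis using that[of P ?P' d \<mu>] PP' H distinct by blast
qed

section \<open>Perturbation of eigenvectors\<close>

lemma det_row_expansion:
  fixes T :: "'a::comm_ring_1^'n^'n"
  shows "(\<Sum>j\<in>UNIV. x $ j * Determinants.det (\<chi> i. if i = k then axis j 1 else T $ i))
    = Determinants.det (\<chi> i. if i = k then x else T $ i)"
proof -
  have "Determinants.det (\<chi> i. if i = k then (\<Sum>j\<in>UNIV. x $ j *s axis j 1) else T $ i)
      = (\<Sum>j\<in>UNIV. Determinants.det (\<chi> i. if i = k then x $ j *s axis j 1 else T $ i))"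
    by (rule det_linear_row_sum) simp
  then show ?thesis unfolding basis_expansion det_row_mul by simp
qed

text \<open>Row \<open>i\<close> against the cofactors of row \<open>k\<close> gives the determinant
  with row \<open>k\<close> replaced by row \<open>i\<close>: either \<open>det T\<close> itself or
  one with two equal rows. The kernel vector is thus polynomial in the entries, hence as smooth as
  they are.\<close>

lemma cofactors_in_kernel:
  fixes T :: "'a::comm_ring_1^'n^'n"
  assumes "Determinants.det T = 0"
  shows "T *v (\<chi> j. Determinants.det (\<chi> i. if i = k then axis j 1 else T $ i)) = 0"
proof -
  have "Determinants.det (\<chi> l. if l = k then T $ i else T $ l) = 0" for i
  proof (cases "i = k")
    case True
    then have "(\<chi> l. if l = k then T $ i else T $ l) = T" by (simp add: vec_eq_iff)
    then show ?thesis using assms by simp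
  next
    case False
    then show ?thesis by (intro det_identical_rows[of i k]) (simp_all add: row_def vec_eq_iff)
  qed
  then show ?thesis
    by (simp add: vec_eq_iff matrix_vector_mult_def det_row_expansion)
qed

text \<open>Up to a simultaneous permutation of rows and columns, such a matrix is block triangular with
  diagonal blocks.\<close>
lemma det_block_diagonal:
  fixes M :: "'a::comm_ring_1^'n^'n"
  assumes out: "\<And>i j. i \<notin> S \<Longrightarrow> j \<noteq> i \<Longrightarrow> M $ i $ j = 0"
    and ins: "\<And>i j. i \<in> S \<Longrightarrow> j \<in> S \<Longrightarrow> j \<noteq> i \<Longrightarrow> M $ i $ j = 0"
  shows "Determinants.det M = (\<Prod>i\<in>UNIV. M $ i $ i)"
proof -
  have "(\<Prod>i\<in>UNIV. M $ i $ p i) = 0" if p: "p permutes UNIV" "p \<noteq> id" for p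
  proof -
    have "\<exists>i. M $ i $ p i = 0"
    proof (rule ccontr)
      assume "\<not> (\<exists>i. M $ i $ p i = 0)"
      then have nz: "M $ i $ p i \<noteq> 0" for i by blast
      have fix_out: "p i = i" if "i \<notin> S" for i using out[OF that] nz by blast
      have "p i = i" for i
      proof (cases "i \<in> S")
        case True
        have "p i \<in> S"
        proof (rule ccontr)
          assume "p i \<notin> S"
          then have "p (p i) = p i" by (rule fix_out)
          then have "p i = i" using permutes_inj[OF p(1)] by (simp add: inj_eq)
          then show False using \<open>p i \<notin> S\<close> True by simp
        qed
        then show ?thesis using ins[OF True] nz by blast
      qed (rule fix_out)
      then show False using p(2) by auto
    qed
    then obtain i where "M $ i $ p i = 0" ..
    then show ?thesis by (intro prod_zero) auto
  qed
  then have "Determinants.det M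
      = (\<Sum>p\<in>{id}. of_int (sign p) * (\<Prod>i\<in>UNIV. M $ i $ p i))"
    unfolding Determinants.det_def by (intro sum.mono_neutral_right) (auto simp: permutes_id)
  then show ?thesis by (simp add: sign_id)
qed

lemma poly_det:
  fixes A :: "'a::comm_ring_1 poly^'n^'n"
  shows "poly (Determinants.det A) x = Determinants.det (\<chi> i j. poly (A $ i $ j) x)"
  by (simp add: Determinants.det_def poly_sum poly_prod)

lemma smooth_poly_det:
  fixes A :: "real \<Rightarrow> real poly^'n^'n"
  assumes "\<And>i j. smooth_poly (\<lambda>h. A h $ i $ j)"
  shows "smooth_poly (\<lambda>h. Determinants.det (A h))"
  unfolding Determinants.det_def of_int_poly
  by (intro smooth_poly_sum smooth_poly_mult smooth_poly_prod smooth_poly_const smooth_on_const assms)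

lemma smooth_on_det:
  assumes "\<And>i j. smooth_on S (\<lambda>h. A h $ i $ j)"
  shows "smooth_on S (\<lambda>h. Determinants.det (A h))"
  unfolding Determinants.det_def
  by (intro smooth_on_sum smooth_on_mult smooth_on_const smooth_on_prod assms)

text \<open>Rows belonging to the eigenvalue of the unperturbed matrix are divided by \<open>h ^ p\<close>, so that the
  system stays regular at \<open>h = 0\<close>.\<close>
lemma perturbed_eigenbranch:
  fixes N :: "real \<Rightarrow> real^'n^'n" and g :: "'n \<Rightarrow> real \<Rightarrow> real" and d \<mu> :: "'n \<Rightarrow> real"
  assumes N: "\<And>i j. smooth_on UNIV (\<lambda>h. N h $ i $ j)" and g: "\<And>i. smooth_on UNIV (g i)"
    and g0: "\<And>i. g i 0 = d i" and g_eq: "\<And>i j. d i = d j \<Longrightarrow> g i = g j" and p: "p \<ge> 1"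
    and N0: "\<And>i j. d i = d j \<Longrightarrow> N 0 $ i $ j = (if i = j then \<mu> j else 0)"
    and distinct: "\<And>i j. i \<noteq> j \<Longrightarrow> d i = d j \<Longrightarrow> \<mu> i \<noteq> \<mu> j"
  obtains \<epsilon> l v where "\<epsilon> > 0" "smooth_on {-\<epsilon><..<\<epsilon>} l" "\<And>j. smooth_on {-\<epsilon><..<\<epsilon>} (\<lambda>h. v h $ j)"
    "l 0 = \<mu> k" "\<And>j. j \<noteq> k \<Longrightarrow> v 0 $ j = 0" "v 0 $ k \<noteq> 0"
    "\<And>h i. \<bar>h\<bar> < \<epsilon> \<Longrightarrow> g i h * v h $ i + h ^ p * (N h *v v h) $ i = (g k h + h ^ p * l h) * v h $ i"
proof -
  \<comment> \<open>The equation for the eigenvalue g k h + h^p x has matrix entries a + b x. In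
    rows with \<open>d i = d k\<close> the functions \<open>g\<close> cancel exactly by
    \<open>g_eq\<close>, everything left carries h^p, and that factor is dropped.\<close>
  define a where "a i j h = (if d i = d k then N h $ i $ j
    else (if i = j then g i h - g k h else 0) + h ^ p * N h $ i $ j)" for i j and h :: real
  define b where "b i j h = (if i = j then if d i = d k then -1 else - (h ^ p) else 0)" for i j and h :: real
  define TP :: "real \<Rightarrow> real poly^'n^'n" where "TP h = (\<chi> i j. [:a i j h, b i j h:])" for h
  define T where "T h x = (\<chi> i j. a i j h + b i j h * x)" for h x
  define Q where "Q h = Determinants.det (TP h)" for h
  have sa: "smooth_on UNIV (a i j)" for i j
  proof (cases "d i = d k")
    case True
    then show ?thesis using N by (simp add: a_def[abs_def])
  next
    case False
    have "smooth_on UNIV (\<lambda>h. (if i = j then g i h - g k h else 0) + h ^ p * N h $ i $ j)"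
      by (intro smooth_on_add smooth_on_mult smooth_on_power smooth_on_ident N)
        (cases "i = j"; simp add: smooth_on_diff smooth_on_const g)
    then show ?thesis using False by (simp add: a_def[abs_def])
  qed
  have sb: "smooth_on UNIV (b i j)" for i j
  proof -
    consider "i \<noteq> j" | "i = j" "d i = d k" | "i = j" "d i \<noteq> d k" by blast
    then show ?thesis
      by cases (simp_all add: b_def[abs_def] smooth_on_const smooth_on_minus smooth_on_power smooth_on_ident)
  qed
  have Q: "smooth_poly Q" unfolding Q_def[abs_def]
    by (intro smooth_poly_det) (simp add: TP_def smooth_poly_linear sa sb)
  have poly_Q: "poly (Q h) x = Determinants.det (T h x)" for h x
    by (simp add: Q_def poly_det T_def TP_def mult.commute)
  define r where "r = (\<Prod>i\<in>UNIV - {k}. TP 0 $ i $ i)"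
  have a0: "a i j 0 = (if d i = d k then N 0 $ i $ j else if i = j then d i - d k else 0)" for i j
    using p by (simp add: a_def g0)
  have b0: "b i j 0 = (if i = j \<and> d i = d k then -1 else 0)" for i j
    using p by (simp add: b_def)
  \<comment> \<open>At \<open>h = 0\<close> rows outside the eigenspace are diagonal, and rows
    inside it are diagonal within their block. Row \<open>k\<close> contributes \<mu> k - x; at x =
    \<mu> k the other factors are differences of \<open>\<mu>\<close> or of \<open>d\<close> and do
    not vanish, so this root is simple.\<close>
  have "Q 0 = (\<Prod>i\<in>UNIV. TP 0 $ i $ i)"
    unfolding Q_def by (rule det_block_diagonal[of "{i. d i = d k}"]) (auto simp: TP_def a0 b0 N0)
  then have Q0: "Q 0 = [:\<mu> k, -1:] * r"
    by (simp add: r_def prod.remove[of UNIV k] TP_def a0 b0 N0)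
  have diag_nz: "a i i 0 + b i i 0 * \<mu> k \<noteq> 0" if "i \<noteq> k" for i
    using distinct[OF that] by (auto simp: a0 b0 N0)
  have r: "poly r (\<mu> k) \<noteq> 0"
    using diag_nz by (auto simp: r_def poly_prod TP_def mult.commute)
  have root: "poly (Q 0) (\<mu> k) = 0" by (simp add: Q0)
  have "poly (pderiv (Q 0)) (\<mu> k) \<noteq> 0" using r unfolding Q0 pderiv_mult by (simp add: pderiv_pCons)
  from implicit_root[OF Q root this] obtain \<epsilon> l where \<epsilon>: "\<epsilon> > 0" and l0: "l 0 = \<mu> k"
    and l_root: "\<And>h. \<bar>h\<bar> < \<epsilon> \<Longrightarrow> poly (Q h) (l h) = 0" and sl: "smooth_on {-\<epsilon><..<\<epsilon>} l" by metis
  define C where "C h j = (\<chi> i. if i = k then axis j 1 else T h (l h) $ i)" for h j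
  define v where "v h = (\<chi> j. Determinants.det (C h j))" for h
  have sv: "smooth_on {-\<epsilon><..<\<epsilon>} (\<lambda>h. v h $ j)" for j
  proof -
    have "smooth_on {-\<epsilon><..<\<epsilon>} (\<lambda>h. C h j $ i $ m)" for i m
      by (cases "i = k") (simp_all add: C_def T_def smooth_on_const smooth_on_add smooth_on_mult sl
          smooth_on_subset[OF sa] smooth_on_subset[OF sb])
    then show ?thesis by (simp add: v_def smooth_on_det)
  qed
  have eq: "g i h * v h $ i + h ^ p * (N h *v v h) $ i = (g k h + h ^ p * l h) * v h $ i"
    if h: "\<bar>h\<bar> < \<epsilon>" for h i
  proof -
    have "Determinants.det (T h (l h)) = 0" using l_root[OF h] by (simp add: poly_Q)
    then have "T h (l h) *v v h = 0" unfolding v_def C_def by (rule cofactors_in_kernel)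
    then have 0: "(\<Sum>j\<in>UNIV. (a i j h + b i j h * l h) * v h $ j) = 0"
      by (simp add: vec_eq_iff matrix_vector_mult_def T_def)
    have Nv: "(N h *v v h) $ i = (\<Sum>j\<in>UNIV. N h $ i $ j * v h $ j)" by (simp add: matrix_vector_mult_def)
    have \<delta>: "(\<Sum>j\<in>UNIV. (if i = j then t else 0) * v h $ j) = t * v h $ i" for t
      by (simp add: if_distrib if_distribR sum.delta' cong: if_cong)
    show ?thesis
    proof (cases "d i = d k")
      case True
      have "(\<Sum>j\<in>UNIV. (a i j h + b i j h * l h) * v h $ j)
          = (\<Sum>j\<in>UNIV. N h $ i $ j * v h $ j + (if i = j then - l h else 0) * v h $ j)"
        by (intro sum.cong refl) (auto simp: a_def b_def True algebra_simps)
      then have "(N h *v v h) $ i = l h * v h $ i" using 0 by (simp add: sum.distrib \<delta> Nv)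
      then show ?thesis using g_eq[OF True] by (simp add: algebra_simps)
    next
      case False
      have "(\<Sum>j\<in>UNIV. (a i j h + b i j h * l h) * v h $ j)
          = (\<Sum>j\<in>UNIV. h ^ p * (N h $ i $ j * v h $ j)
              + (if i = j then g i h - g k h - h ^ p * l h else 0) * v h $ j)"
        by (intro sum.cong refl) (auto simp: a_def b_def False algebra_simps)
      then have "h ^ p * (N h *v v h) $ i + (g i h - g k h - h ^ p * l h) * v h $ i = 0"
        using 0 by (simp add: sum.distrib \<delta> Nv sum_distrib_left)
      then show ?thesis by (simp add: algebra_simps)
    qed
  qed
  have T0: "T 0 (l 0) $ i $ j = (if d i = d k then N 0 $ i $ j - (if i = j then \<mu> k else 0)
      else if i = j then d i - d k else 0)" for i j
    by (simp add: T_def a0 b0 l0)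
  \<comment> \<open>At the root, column \<open>k\<close> of the unperturbed system is zero, and
    replacing row \<open>k\<close> by another unit vector does not repair it.\<close>
  have "v 0 $ j = 0" if "j \<noteq> k" for j
  proof -
    have "column k (C 0 j) = 0"
      using that by (auto simp: vec_eq_iff column_def C_def axis_def T0 N0)
    then show ?thesis by (simp add: v_def det_zero_column)
  qed
  moreover have "v 0 $ k \<noteq> 0"
  proof -
    \<comment> \<open>Putting the \<open>k\<close>-th unit vector into row \<open>k\<close>
      preserves the block shape; the diagonal then consists of 1 and nonzero differences.\<close>
    have "Determinants.det (C 0 k) = (\<Prod>i\<in>UNIV. C 0 k $ i $ i)"
      by (rule det_block_diagonal[of "{i. d i = d k}"]) (auto simp: C_def T0 N0 axis_def)
    moreover have "C 0 k $ i $ i \<noteq> 0" for i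
      using distinct[of i k] by (auto simp: C_def T0 N0 axis_def)
    ultimately show ?thesis by (simp add: v_def)
  qed
  ultimately show thesis using that[of \<epsilon> l v] \<epsilon> sl sv l0 eq by blast
qed

text \<open>The finitely many branches are restricted to the smallest of their intervals. That
  \<open>V 0\<close> is diagonal ensures later that the basis at \<open>h = 0\<close> is the adapted
  one up to rescaling its columns.\<close>

lemma perturbed_eigenbasis:
  fixes N :: "real \<Rightarrow> real^'n^'n" and g :: "'n \<Rightarrow> real \<Rightarrow> real" and d \<mu> :: "'n \<Rightarrow> real"
  assumes N: "\<And>i j. smooth_on UNIV (\<lambda>h. N h $ i $ j)" and g: "\<And>i. smooth_on UNIV (g i)"
    and g0: "\<And>i. g i 0 = d i" and g_eq: "\<And>i j. d i = d j \<Longrightarrow> g i = g j" and p: "p \<ge> 1"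
    and N0: "\<And>i j. d i = d j \<Longrightarrow> N 0 $ i $ j = (if i = j then \<mu> j else 0)"
    and distinct: "\<And>i j. i \<noteq> j \<Longrightarrow> d i = d j \<Longrightarrow> \<mu> i \<noteq> \<mu> j"
  obtains \<epsilon> l V c where "\<epsilon> > 0" "\<And>k. smooth_on {-\<epsilon><..<\<epsilon>} (l k)"
    "\<And>i j. smooth_on {-\<epsilon><..<\<epsilon>} (\<lambda>h. V h $ i $ j)" "\<And>k. l k 0 = \<mu> k"
    "V 0 = diagm c" "\<And>k. c k \<noteq> 0"
    "\<And>h i k. \<bar>h\<bar> < \<epsilon> \<Longrightarrow> g i h * V h $ i $ k + h ^ p * (N h ** V h) $ i $ k = (g k h + h ^ p * l k h) * V h $ i $ k"
proof -
  define good where "good k \<epsilon> l v \<longleftrightarrow> \<epsilon> > 0 \<and> smooth_on {-\<epsilon><..<\<epsilon>} l \<and> (\<forall>j. smooth_on {-\<epsilon><..<\<epsilon>} (\<lambda>h. v h $ j)) \<and>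
    l 0 = \<mu> k \<and> (\<forall>j. j \<noteq> k \<longrightarrow> v 0 $ j = 0) \<and> v 0 $ k \<noteq> 0 \<and>
    (\<forall>h i. \<bar>h\<bar> < \<epsilon> \<longrightarrow> g i h * v h $ i + h ^ p * (N h *v v h) $ i = (g k h + h ^ p * l h) * v h $ i)"
    for k and \<epsilon> :: real and l :: "real \<Rightarrow> real" and v :: "real \<Rightarrow> real^'n"
  have "\<exists>\<epsilon> l v. good k \<epsilon> l v" for k
  proof (rule perturbed_eigenbranch[OF assms, where k=k])
    fix \<epsilon> :: real and l :: "real \<Rightarrow> real" and v :: "real \<Rightarrow> real^'n"
    assume "0 < \<epsilon>" "smooth_on {-\<epsilon><..<\<epsilon>} l" "\<And>j. smooth_on {-\<epsilon><..<\<epsilon>} (\<lambda>h. v h $ j)"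
      "l 0 = \<mu> k" "\<And>j. j \<noteq> k \<Longrightarrow> v 0 $ j = 0" "v 0 $ k \<noteq> 0"
      "\<And>h i. \<bar>h\<bar> < \<epsilon> \<Longrightarrow> g i h * v h $ i + h ^ p * (N h *v v h) $ i = (g k h + h ^ p * l h) * v h $ i"
    then have "good k \<epsilon> l v" unfolding good_def by blast
    then show ?thesis by blast
  qed
  then have "\<forall>k. \<exists>\<epsilon> l v. good k \<epsilon> l v" ..
  from choice[OF this] obtain \<epsilon> where "\<forall>k. \<exists>l v. good k (\<epsilon> k) l v" ..
  from choice[OF this] obtain l where "\<forall>k. \<exists>v. good k (\<epsilon> k) (l k) v" ..
  from choice[OF this] obtain v where v: "\<And>k. good k (\<epsilon> k) (l k) (v k)" by blast
  have pos: "\<epsilon> k > 0" and sl: "smooth_on {-\<epsilon> k<..<\<epsilon> k} (l k)"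
    and sv: "smooth_on {-\<epsilon> k<..<\<epsilon> k} (\<lambda>h. v k h $ j)"
    and l0: "l k 0 = \<mu> k" and v0: "j \<noteq> k \<Longrightarrow> v k 0 $ j = 0" and v0_nz: "v k 0 $ k \<noteq> 0"
    and eq: "\<bar>h\<bar> < \<epsilon> k \<Longrightarrow>
      g i h * v k h $ i + h ^ p * (N h *v v k h) $ i = (g k h + h ^ p * l k h) * v k h $ i" for k j h i
    using v[of k] by (simp_all add: good_def)
  define e where "e = Min (range \<epsilon>)"
  have "e > 0" unfolding e_def using pos by (subst Min_gr_iff) auto
  have e_le: "e \<le> \<epsilon> k" for k unfolding e_def by (intro Min_le) auto
  have sub: "{-e<..<e} \<subseteq> {- \<epsilon> k<..<\<epsilon> k}" for k
    using e_le[of k] by (intro subsetI) simp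
  define V where "V h = (\<chi> i k. v k h $ i)" for h
  have NV: "(N h ** V h) $ i $ k = (N h *v v k h) $ i" for h i k
    by (simp add: V_def matrix_matrix_mult_def matrix_vector_mult_def)
  show thesis
  proof (rule that[of e l V "\<lambda>k. v k 0 $ k"])
    show "e > 0" by fact
    show "smooth_on {-e<..<e} (l k)" for k by (rule smooth_on_subset[OF sl sub])
    show "smooth_on {-e<..<e} (\<lambda>h. V h $ i $ j)" for i j
      using smooth_on_subset[OF sv sub] by (simp add: V_def)
    show "l k 0 = \<mu> k" for k by (rule l0)
    show "v k 0 $ k \<noteq> 0" for k by (rule v0_nz)
    show "V 0 = diagm (\<lambda>k. v k 0 $ k)" by (auto simp: vec_eq_iff V_def diagm_nth v0)
    fix h i k assume "\<bar>h\<bar> < e"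
    then have "\<bar>h\<bar> < \<epsilon> k" using e_le[of k] by linarith
    from eq[OF this]
    show "g i h * V h $ i $ k + h ^ p * (N h ** V h) $ i $ k = (g k h + h ^ p * l k h) * V h $ i $ k"
      unfolding NV by (simp add: V_def)
  qed
qed

section \<open>Simultaneous diagonalization\<close>

lemma matrix_add_mult_distrib: "(A + B) ** C = A ** C + B ** (C :: 'a::semiring_1^'n^'m)"
  by (simp add: vec_eq_iff matrix_matrix_mult_def distrib_right sum.distrib)

text \<open>Through such functionals smoothness and the order estimate pass from the matrix family
  to scalar functions in the adapted basis.\<close>

lemma bounded_linear_conjugated_entry:
  fixes P P' :: "complex^'n^'n"
  shows "bounded_linear (\<lambda>M. (P' ** M ** P) $ i $ j)"
proof -
  have "(P' ** (M + M') ** P) $ i $ j = (P' ** M ** P) $ i $ j + (P' ** M' ** P) $ i $ j" for M M'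
    by (simp add: matrix_add_ldistrib matrix_add_mult_distrib)
  moreover have "(P' ** (r *\<^sub>R M) ** P) $ i $ j = r *\<^sub>R ((P' ** M ** P) $ i $ j)" for r M
    by (simp add: matrix_matrix_mult_def sum_distrib_left sum_distrib_right scaleR_sum_right)
  ultimately have "linear (\<lambda>M. (P' ** M ** P) $ i $ j)" by (intro linearI)
  then show ?thesis by (simp add: linear_conv_bounded_linear)
qed

lemma bounded_linear_bigo:
  assumes "bounded_linear l" and "(\<lambda>h. norm (E h)) \<in> O[F](w)"
  shows "(\<lambda>h. l (E h) :: real) \<in> O[F](w)"
proof -
  obtain K where "\<And>x. norm (l x) \<le> norm x * K" using bounded_linear.bounded[OF assms(1)] by blast
  then have "(\<lambda>h. l (E h)) \<in> O[F](\<lambda>h. norm (E h))"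
    by (intro bigoI[of _ K]) (simp add: mult.commute)
  then show ?thesis using assms(2) by (rule landau_o.big_trans)
qed

text \<open>For small \<open>h \<noteq> 0\<close> the imaginary part \<open>Y\<close> has simple spectrum \<open>s\<close>, and the real part \<open>X\<close>
  commutes with it, so both are diagonal in the basis \<open>V\<close>.\<close>
lemma diagonal_of_commuting_parts:
  fixes X Y V :: "real^'n^'n" and s :: "'n \<Rightarrow> real"
  assumes V: "invertible V" and YV: "Y ** V = V ** diagm s" and inj: "inj s"
    and comm: "X ** Y = Y ** X" and sq: "X ** X + Y ** Y = Finite_Cartesian_Product.mat 1"
    and pos: "\<And>k. (X ** V) $ k $ k * V $ k $ k > 0"
  shows "X ** V = V ** diagm (\<lambda>k. sqrt (1 - (s k)\<^sup>2))" and "\<And>k. \<bar>s k\<bar> < 1"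
proof -
  let ?W = "matrix_inv V"
  note VW = matrix_inv_right_left[OF V]
  define K where "K = ?W ** X ** V"
  have XV: "X ** V = V ** K" using VW by (simp add: K_def matrix_mul_assoc)
  have VKs: "V ** (K ** diagm s) = V ** (diagm s ** K)"
  proof -
    have "V ** (K ** diagm s) = X ** (V ** diagm s)" by (simp add: matrix_mul_assoc XV)
    also have "\<dots> = Y ** X ** V" by (simp add: matrix_mul_assoc comm flip: YV)
    also have "\<dots> = Y ** V ** K" by (simp add: XV flip: matrix_mul_assoc)
    finally show ?thesis by (simp add: YV matrix_mul_assoc)
  qed
  have cancel: "A = B" if "V ** A = V ** B" for A B :: "real^'n^'n"
  proof -
    have "?W ** (V ** A) = ?W ** (V ** B)" using that by simp
    then show ?thesis using VW by (simp add: matrix_mul_assoc)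
  qed
  have Ks: "K $ i $ j * s j = s i * K $ i $ j" for i j
    using cancel[OF VKs] by (metis mult_diagm_nth diagm_mult_nth)
  have "K $ i $ j = 0" if "i \<noteq> j" for i j
    using Ks[of i j] injD[OF inj, of i j] that by (auto simp: mult.commute)
  then have "diagonal K" by (simp add: diagonal_def)
  then obtain \<alpha> where K: "K = diagm \<alpha>" using diagonal_imp_diagm by blast
  have "V ** diagm (\<lambda>k. \<alpha> k * \<alpha> k + s k * s k) = V ** diagm (\<lambda>_. 1)"
  proof -
    have "diagm (\<lambda>k. \<alpha> k * \<alpha> k + s k * s k) = diagm \<alpha> ** diagm \<alpha> + diagm s ** diagm s"
      by (simp add: vec_eq_iff diagm_mult_diagm diagm_nth)
    also have "V ** \<dots> = V ** diagm \<alpha> ** diagm \<alpha> + V ** diagm s ** diagm s"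
      by (simp add: matrix_add_ldistrib matrix_mul_assoc)
    also have "\<dots> = X ** (V ** diagm \<alpha>) + Y ** (V ** diagm s)"
      using XV YV by (simp add: K matrix_mul_assoc)
    also have "\<dots> = X ** X ** V + Y ** Y ** V"
      using XV YV by (simp add: K flip: matrix_mul_assoc)
    also have "\<dots> = V" by (simp add: sq flip: matrix_add_mult_distrib)
    finally show ?thesis by (simp add: diagm_one)
  qed
  from cancel[OF this] have "diagm (\<lambda>k. \<alpha> k * \<alpha> k + s k * s k) $ k $ k = diagm (\<lambda>_. 1 :: real) $ k $ k" for k
    by simp
  then have circle: "\<alpha> k * \<alpha> k + s k * s k = 1" for k by (simp add: diagm_nth)
  have \<alpha>: "\<alpha> k > 0" for k
  proof -
    \<comment> \<open>The positivity hypothesis equals \<alpha> k times the square of a diagonal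
      entry of \<open>V\<close>; it fixes the sign of \<alpha> k whatever the scaling of the
      eigenvector.\<close>
    have "\<alpha> k * (V $ k $ k * V $ k $ k) > 0"
      using pos[of k] by (simp add: XV K mult_diagm_nth algebra_simps)
    then show ?thesis by (simp add: zero_less_mult_iff not_square_less_zero)
  qed
  have "\<alpha> = (\<lambda>k. sqrt (1 - (s k)\<^sup>2))"
  proof
    fix k show "\<alpha> k = sqrt (1 - (s k)\<^sup>2)"
      using circle[of k] \<alpha>[of k] by (intro real_sqrt_unique[symmetric]) (auto simp: power2_eq_square)
  qed
  with XV K show "X ** V = V ** diagm (\<lambda>k. sqrt (1 - (s k)\<^sup>2))" by (simp only:)
  show "\<bar>s k\<bar> < 1" for k
  proof -
    have "0 < \<alpha> k * \<alpha> k" using \<alpha>[of k] by simp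
    then have "(s k)\<^sup>2 < 1" using circle[of k] by (simp add: power2_eq_square)
    then show ?thesis by (simp add: abs_square_less_1)
  qed
qed

text \<open>An eigenpair of \<open>Y / h\<close> is one of \<open>Y\<close> with eigenvalue
  multiplied by \<open>h\<close>. Shrinking the interval secures three open conditions:
  \<open>V\<close> stays invertible, the diagonal entries have the sign that selects the root, and
  the eigenvalues are distinct away from \<open>h = 0\<close>.\<close>

lemma smooth_local_diagonalization:
  fixes X Y N :: "real \<Rightarrow> real^'n^'n" and g :: "'n \<Rightarrow> real \<Rightarrow> real" and d \<mu> :: "'n \<Rightarrow> real"
  assumes N: "\<And>i j. smooth_on UNIV (\<lambda>h. N h $ i $ j)" and g: "\<And>i. smooth_on UNIV (g i)"
    and g0: "\<And>i. g i 0 = d i" and g_eq: "\<And>i j. d i = d j \<Longrightarrow> g i = g j" and p: "p \<ge> 1"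
    and N0: "\<And>i j. d i = d j \<Longrightarrow> N 0 $ i $ j = (if i = j then \<mu> j else 0)"
    and distinct: "\<And>i j. i \<noteq> j \<Longrightarrow> d i = d j \<Longrightarrow> \<mu> i \<noteq> \<mu> j"
    and X: "\<And>i j. isCont (\<lambda>h. X h $ i $ j) 0" and X0: "X 0 = Finite_Cartesian_Product.mat 1"
    and Y: "\<And>h i j. Y h $ i $ j = (if i = j then h * g i h else 0) + h ^ (p + 1) * N h $ i $ j"
    and comm: "\<And>h. X h ** Y h = Y h ** X h"
    and sq: "\<And>h. X h ** X h + Y h ** Y h = Finite_Cartesian_Product.mat 1"
  obtains \<delta> V s c where "\<delta> > 0" "\<And>i j. smooth_on {-\<delta><..<\<delta>} (\<lambda>h. V h $ i $ j)"
    "\<And>k. smooth_on {-\<delta><..<\<delta>} (s k)" "V 0 = diagm c" "\<And>k. c k \<noteq> 0" "\<And>k. s k 0 = 0"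
    "\<And>h. \<bar>h\<bar> < \<delta> \<Longrightarrow> invertible (V h) \<and> (\<forall>k. \<bar>s k h\<bar> < 1) \<and> Y h ** V h = V h ** diagm (\<lambda>k. s k h) \<and>
      X h ** V h = V h ** diagm (\<lambda>k. sqrt (1 - (s k h)\<^sup>2))"
proof (rule perturbed_eigenbasis[of N g d p \<mu>, OF N g g0 g_eq p N0 distinct])
  fix \<epsilon> :: real and l :: "'n \<Rightarrow> real \<Rightarrow> real" and V :: "real \<Rightarrow> real^'n^'n" and c :: "'n \<Rightarrow> real"
  assume \<epsilon>: "\<epsilon> > 0" and l: "\<And>k. smooth_on {-\<epsilon><..<\<epsilon>} (l k)"
    and V: "\<And>i j. smooth_on {-\<epsilon><..<\<epsilon>} (\<lambda>h. V h $ i $ j)" and l0: "\<And>k. l k 0 = \<mu> k"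
    and V0: "V 0 = diagm c" and c: "\<And>k. c k \<noteq> 0"
    and ev: "\<And>h i k. \<bar>h\<bar> < \<epsilon> \<Longrightarrow>
      g i h * V h $ i $ k + h ^ p * (N h ** V h) $ i $ k = (g k h + h ^ p * l k h) * V h $ i $ k"
  define t where "t k h = g k h + h ^ p * l k h" for k and h :: real
  define s where "s k h = h * t k h" for k and h :: real
  have t: "smooth_on {-\<epsilon><..<\<epsilon>} (t k)" for k
    unfolding t_def[abs_def]
    by (intro smooth_on_add smooth_on_mult smooth_on_power smooth_on_ident l smooth_on_subset[OF g]) simp
  have s: "smooth_on {-\<epsilon><..<\<epsilon>} (s k)" for k
    unfolding s_def[abs_def] by (intro smooth_on_mult smooth_on_ident t)
  have lim: "(f \<longlongrightarrow> f 0) (at 0)" if "smooth_on {-\<epsilon><..<\<epsilon>} f" for f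
    using smooth_on_imp_isCont[OF that] \<epsilon> by (simp add: isCont_def)
  have YV: "Y h ** V h = V h ** diagm (\<lambda>k. s k h)" if h: "\<bar>h\<bar> < \<epsilon>" for h
  proof -
    have "(Y h ** V h) $ i $ k = h * (g i h * V h $ i $ k + h ^ p * (N h ** V h) $ i $ k)" for i k
    proof -
      have "(Y h ** V h) $ i $ k
          = (\<Sum>j\<in>UNIV. (if i = j then h * g i h * V h $ i $ k else 0) + h ^ (p + 1) * (N h $ i $ j * V h $ j $ k))"
        unfolding matrix_matrix_mult_def vec_lambda_beta
        by (intro sum.cong refl) (auto simp: Y algebra_simps)
      also have "\<dots> = h * g i h * V h $ i $ k + h ^ (p + 1) * (N h ** V h) $ i $ k"
        by (simp add: sum.distrib sum.delta' matrix_matrix_mult_def flip: sum_distrib_left)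
      finally show ?thesis by (simp add: algebra_simps)
    qed
    then show ?thesis unfolding vec_eq_iff mult_diagm_nth ev[OF h] by (simp add: s_def t_def mult_ac)
  qed
  have ev_det: "\<forall>\<^sub>F h in at 0. Determinants.det (V h) \<noteq> 0"
  proof (rule tendsto_imp_eventually_ne)
    show "((\<lambda>h. Determinants.det (V h)) \<longlongrightarrow> Determinants.det (V 0)) (at 0)"
      by (rule lim) (rule smooth_on_det[OF V])
    have "Determinants.det (V 0) = (\<Prod>i\<in>UNIV. V 0 $ i $ i)"
      by (rule det_block_diagonal[of UNIV]) (auto simp: V0 diagm_nth)
    then show "Determinants.det (V 0) \<noteq> 0" using c by (simp add: V0 diagm_nth)
  qed
  have ev_pos: "\<forall>\<^sub>F h in at 0. \<forall>k. (X h ** V h) $ k $ k * V h $ k $ k > 0"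
  proof (rule eventually_all_finite)
    fix k
    have X_lim: "((\<lambda>h. X h $ i $ j) \<longlongrightarrow> X 0 $ i $ j) (at 0)" for i j
      using X by (simp add: isCont_def)
    have "((\<lambda>h. (X h ** V h) $ k $ k * V h $ k $ k) \<longlongrightarrow> (X 0 ** V 0) $ k $ k * V 0 $ k $ k) (at 0)"
      unfolding matrix_matrix_mult_def vec_lambda_beta
      by (intro tendsto_mult tendsto_sum X_lim lim[OF V])
    then have "((\<lambda>h. (X h ** V h) $ k $ k * V h $ k $ k) \<longlongrightarrow> c k * c k) (at 0)"
      by (simp add: X0 V0 diagm_nth)
    moreover have "c k * c k > 0" using c[of k] not_real_square_gt_zero by blast
    ultimately show "\<forall>\<^sub>F h in at 0. (X h ** V h) $ k $ k * V h $ k $ k > 0"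
      by (rule order_tendstoD(1))
  qed
  \<comment> \<open>Different \<open>d\<close> separate the eigenvalues at order h; equal
    \<open>d\<close> leave only the difference of the branches \<open>l\<close>, of order h^(p+1),
    which starts at a nonzero difference of \<open>\<mu>\<close>.\<close>
  have ev_ne: "\<forall>\<^sub>F h in at 0. \<forall>i j. i \<noteq> j \<longrightarrow> s i h \<noteq> s j h"
  proof (intro eventually_all_finite)
    fix i j
    have nz: "\<forall>\<^sub>F h in at 0. h \<noteq> (0::real)" by (simp add: eventually_at_filter)
    show "\<forall>\<^sub>F h in at 0. i \<noteq> j \<longrightarrow> s i h \<noteq> s j h"
    proof (cases "d i = d j")
      case True
      show ?thesis
      proof (cases "i = j")
        case False
        have "((\<lambda>h. l i h - l j h) \<longlongrightarrow> l i 0 - l j 0) (at 0)" by (intro tendsto_diff lim l)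
        then have "\<forall>\<^sub>F h in at 0. l i h - l j h \<noteq> 0"
          by (rule tendsto_imp_eventually_ne) (use distinct[OF False True] in \<open>simp add: l0\<close>)
        with nz show ?thesis
          by eventually_elim (simp add: s_def t_def g_eq[OF True])
      qed simp
    next
      case False
      have "((\<lambda>h. t i h - t j h) \<longlongrightarrow> t i 0 - t j 0) (at 0)" by (intro tendsto_diff lim t)
      then have "\<forall>\<^sub>F h in at 0. t i h - t j h \<noteq> 0"
        by (rule tendsto_imp_eventually_ne) (use False p in \<open>simp add: t_def g0 power_0_left\<close>)
      with nz show ?thesis by eventually_elim (simp add: s_def)
    qed
  qed
  have "\<forall>\<^sub>F h in at 0. Determinants.det (V h) \<noteq> 0 \<and> (\<forall>k. (X h ** V h) $ k $ k * V h $ k $ k > 0) \<and>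
      (\<forall>i j. i \<noteq> j \<longrightarrow> s i h \<noteq> s j h)"
    using ev_det ev_pos ev_ne by eventually_elim blast
  then obtain e where e: "e > 0" and near: "\<And>h. h \<noteq> 0 \<Longrightarrow> \<bar>h\<bar> < e \<Longrightarrow> Determinants.det (V h) \<noteq> 0 \<and>
      (\<forall>k. (X h ** V h) $ k $ k * V h $ k $ k > 0) \<and> (\<forall>i j. i \<noteq> j \<longrightarrow> s i h \<noteq> s j h)"
    unfolding eventually_at by (auto simp: dist_real_def)
  define \<delta> where "\<delta> = min \<epsilon> e"
  have \<delta>: "\<delta> > 0" "{-\<delta><..<\<delta>} \<subseteq> {-\<epsilon><..<\<epsilon>}" using \<epsilon> e by (auto simp: \<delta>_def)
  have main: "invertible (V h) \<and> (\<forall>k. \<bar>s k h\<bar> < 1) \<and> Y h ** V h = V h ** diagm (\<lambda>k. s k h) \<and>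
      X h ** V h = V h ** diagm (\<lambda>k. sqrt (1 - (s k h)\<^sup>2))" if h: "\<bar>h\<bar> < \<delta>" for h
  proof (cases "h = 0")
    \<comment> \<open>All eigenvalues of \<open>Y 0\<close> coincide, so commutation yields nothing
      here; instead \<open>X 0\<close> is the identity and every \<open>s k 0\<close> is
      zero.\<close>
    case True
    have "diagm c ** diagm (\<lambda>k. inverse (c k)) = Finite_Cartesian_Product.mat 1"
      "diagm (\<lambda>k. inverse (c k)) ** diagm c = Finite_Cartesian_Product.mat 1"
      using c by (simp_all add: diagm_mult_diagm diagm_one)
    then have "invertible (V 0)" unfolding V0 by (rule inverse_matrix_unique(1))
    then show ?thesis using YV[of 0] \<epsilon> unfolding True by (simp add: s_def X0 diagm_one)
  next
    case False
    have hh: "\<bar>h\<bar> < e" "\<bar>h\<bar> < \<epsilon>" using h by (auto simp: \<delta>_def)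
    have inv: "invertible (V h)" using near[OF False hh(1)] by (simp add: invertible_det_nz)
    have inj: "inj (\<lambda>k. s k h)" using near[OF False hh(1)] by (intro injI) blast
    have pos: "\<And>k. (X h ** V h) $ k $ k * V h $ k $ k > 0" using near[OF False hh(1)] by blast
    note diagonal_of_commuting_parts[OF inv YV[OF hh(2)] inj comm sq pos]
    then show ?thesis using inv YV[OF hh(2)] by blast
  qed
  show thesis
    by (rule that[of \<delta> V s c])
      (use \<delta>(1) main c V0 smooth_on_subset[OF V \<delta>(2)] smooth_on_subset[OF s \<delta>(2)] in \<open>simp_all add: s_def\<close>)
qed

lemma cscale_cmat_diagm: "cscale z (cmat (diagm a)) = diagm (\<lambda>i. z * complex_of_real (a i))"
  by (simp add: vec_eq_iff cscale_def diagm_nth)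

lemma smooth_on_linear_image:
  fixes S :: "real \<Rightarrow> 'a::real_normed_vector" and l :: "'a \<Rightarrow> real"
  assumes "bounded_linear l" "smooth S"
  shows "smooth_on UNIV (\<lambda>h. l (S h))"
  using smooth_bounded_linear[OF assms] by (simp add: smooth_iff_smooth_on)

text \<open>A real change of basis commutes with entrywise conjugation, so (X - iY)(X + iY) = 1; its
  real part is the sum of squares, its imaginary part the commutator.\<close>

lemma conjugation_parts:
  fixes S :: "complex^'n^'n" and P P' :: "real^'n^'n"
  assumes PP': "P ** P' = Finite_Cartesian_Product.mat 1" "P' ** P = Finite_Cartesian_Product.mat 1"
    and rev: "map_matrix cnj S ** S = Finite_Cartesian_Product.mat 1"
  defines "X \<equiv> map_matrix Re (cmat P' ** S ** cmat P)" and "Y \<equiv> map_matrix Im (cmat P' ** S ** cmat P)"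
  shows "X ** Y = Y ** X" "X ** X + Y ** Y = Finite_Cartesian_Product.mat 1"
proof -
  let ?S = "cmat P' ** S ** cmat P"
  have cnj_mult: "map_matrix cnj (A ** B) = map_matrix cnj A ** map_matrix cnj B" for A B :: "complex^'n^'n"
    by (simp add: vec_eq_iff matrix_matrix_mult_def)
  have cnj_cmat: "map_matrix cnj (cmat A) = cmat A" for A :: "real^'n^'n" by (simp add: vec_eq_iff)
  have "map_matrix cnj ?S ** ?S = cmat P' ** map_matrix cnj S ** (cmat P ** cmat P') ** S ** cmat P"
    by (simp add: cnj_mult cnj_cmat matrix_mul_assoc)
  also have "\<dots> = cmat P' ** (map_matrix cnj S ** S) ** cmat P"
    by (simp add: PP' cmat_one matrix_mul_assoc flip: cmat_mult)
  also have "\<dots> = Finite_Cartesian_Product.mat 1" by (simp add: rev PP' cmat_one flip: cmat_mult)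
  finally have eq: "(map_matrix cnj ?S ** ?S) $ i $ j = (if i = j then 1 else 0)" for i j
    by (simp add: Finite_Cartesian_Product.mat_def)
  have "Re ((map_matrix cnj ?S ** ?S) $ i $ j) = (X ** X + Y ** Y) $ i $ j" for i j
    by (subst matrix_matrix_mult_def) (simp add: X_def Y_def matrix_matrix_mult_def[of "map_matrix _ _"] sum.distrib)
  then have "(X ** X + Y ** Y) $ i $ j = Re (if i = j then 1 else 0)" for i j by (simp only: eq)
  then show "X ** X + Y ** Y = Finite_Cartesian_Product.mat 1"
    by (simp add: vec_eq_iff Finite_Cartesian_Product.mat_def del: vector_add_component)
  have "Im ((map_matrix cnj ?S ** ?S) $ i $ j) = (X ** Y - Y ** X) $ i $ j" for i j
    by (subst matrix_matrix_mult_def) (simp add: X_def Y_def matrix_matrix_mult_def[of "map_matrix _ _"] sum_subtractf)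
  then have "(X ** Y - Y ** X) $ i $ j = Im (if i = j then 1 else 0)" for i j by (simp only: eq)
  then have "X ** Y - Y ** X = 0" by (simp add: vec_eq_iff del: vector_minus_component)
  then show "X ** Y = Y ** X" by simp
qed

text \<open>The quotient is chosen per eigenvalue \<open>t\<close>, not per index, so indices with
  equal eigenvalue share the same function.\<close>

lemma smooth_sin_quotient:
  obtains G :: "real \<Rightarrow> real \<Rightarrow> real"
  where "\<And>t. smooth_on UNIV (G t)" "\<And>t h. sin (h * t) = h * G t h" "\<And>t. G t 0 = t"
proof -
  have "\<exists>g. smooth_on UNIV g \<and> (\<forall>h. sin (h * t) = h * g h) \<and> g 0 = t" for t :: real
  proof (rule hadamard[of "\<lambda>h. sin (h * t)"])
    show "smooth_on UNIV (\<lambda>h. sin (h * t))"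
      by (intro smooth_on_compose[OF smooth_on_sin] smooth_on_mult smooth_on_ident smooth_on_const) simp
    fix g assume g: "smooth_on UNIV g" "\<And>h. sin (h * t) = h * g h" "g 0 = deriv (\<lambda>h. sin (h * t)) 0"
    have "((\<lambda>h. sin (h * t)) has_real_derivative t) (at 0)" by (auto intro!: derivative_eq_intros)
    then have "g 0 = t" using g(3) DERIV_imp_deriv by metis
    then show ?thesis using g by blast
  qed simp
  then have "\<forall>t. \<exists>g. smooth_on UNIV g \<and> (\<forall>h. sin (h * t) = h * g h) \<and> g 0 = t" ..
  from choice[OF this] obtain G where
    "\<forall>t. smooth_on UNIV (G t) \<and> (\<forall>h. sin (h * t) = h * G t h) \<and> G t 0 = t" ..
  then show thesis by (intro that[of G]) simp_all
qed

theorem theorem3p3: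
  fixes H R :: "real^'n^'n"
    and S :: "real \<Rightarrow> complex^'n^'n"
    and p :: nat
    and B :: "complex^'n^'n"
  assumes smooth_S: "smooth S"
    and reversible: "\<And>h. invertible (S h) \<and> map_matrix cnj (S h) = matrix_inv (S h)"
    and order_p: "p \<ge> 1"
    and consistent:
      "(\<lambda>h. norm (S h - (mexp (cscale (\<i> * complex_of_real h) (cmat H))
                          + cscale (\<i> * complex_of_real h ^ (p + 1)) (cmat R))))
         \<in> O[at 0](\<lambda>h. h ^ (p + 2))"
    and H_diag: "diagonalizable (cmat H)"
    and H_real: "spectrum (cmat H) \<subseteq> \<real>"
    and simple:
      "\<And>\<omega> \<mu>. \<omega> \<in> spectrum (cmat H) \<Longrightarrow>
         endo_eigenvalue (eigenspace (cmat H) \<omega>)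
           (\<lambda>v. spectral_projector (cmat H) \<omega> *v (cmat R *v v)) \<mu> \<Longrightarrow>
         \<mu> \<in> \<real> \<and>
         endo_simple_eigenvalue (eigenspace (cmat H) \<omega>)
           (\<lambda>v. spectral_projector (cmat H) \<omega> *v (cmat R *v v)) \<mu>"
    and B_def: "B = (\<Sum>\<omega>\<in>spectrum (cmat H).
       spectral_projector (cmat H) \<omega> ** cmat R ** spectral_projector (cmat H) \<omega>)"
  shows "\<exists>(D :: real \<Rightarrow> real^'n^'n) (P :: real \<Rightarrow> real^'n^'n).
     smooth D \<and> (\<forall>h. diagonal (D h)) \<and>
     smooth P \<and> (\<forall>h. invertible (P h)) \<and>
     diagonal (matrix_inv (cmat (P 0)) ** B ** cmat (P 0)) \<and>
     diagonal (matrix_inv (P 0) ** H ** P 0) \<and>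
     (\<exists>\<epsilon>>0. \<forall>h. \<bar>h\<bar> < \<epsilon> \<longrightarrow>
        S h = cmat (P h) ** mexp (cscale (\<i> * complex_of_real h) (cmat (D h)))
                ** matrix_inv (cmat (P h)))"
proof (rule real_adapted_basis[OF H_diag H_real simple])
  fix P P' :: "real^'n^'n" and d \<mu> :: "'n \<Rightarrow> real"
  assume PP': "P ** P' = Finite_Cartesian_Product.mat 1" and P'P: "P' ** P = Finite_Cartesian_Product.mat 1"
    and H_eq: "H = P ** diagm d ** P'" and distinct: "\<And>i j. i \<noteq> j \<Longrightarrow> d i = d j \<Longrightarrow> \<mu> i \<noteq> \<mu> j"
    and R': "\<And>i j. d i = d j \<Longrightarrow> (P' ** R ** P) $ i $ j = (if i = j then \<mu> j else 0)"
  have cPP': "cmat P ** cmat P' = Finite_Cartesian_Product.mat 1"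
    and cP'P: "cmat P' ** cmat P = Finite_Cartesian_Product.mat 1"
    by (simp_all add: PP' P'P cmat_one flip: cmat_mult)
  interpret diagonalized "cmat H" "cmat P" "cmat P'" "\<lambda>i. complex_of_real (d i)"
    by unfold_locales (simp_all add: cPP' cP'P H_eq cmat_mult cmat_diagm)
  define entry where "entry i j M = (cmat P' ** M ** cmat P) $ i $ j" for i j and M :: "complex^'n^'n"
  have entry: "bounded_linear (entry i j)" for i j
    unfolding entry_def[abs_def] by (rule bounded_linear_conjugated_entry)
  note entry_lin = bounded_linear.linear[OF entry]
  note entry_Re = bounded_linear_compose[OF bounded_linear_Re entry]
  note entry_Im = bounded_linear_compose[OF bounded_linear_Im entry]
  define E where "E h = S h - (mexp (cscale (\<i> * complex_of_real h) (cmat H))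
      + cscale (\<i> * complex_of_real h ^ (p + 1)) (cmat R))" for h
  have E: "(\<lambda>h. norm (E h)) \<in> O[at 0](\<lambda>h. h ^ Suc (p + 1))" using consistent by (simp add: E_def)
  \<comment> \<open>In the adapted basis the exponential is diagonal, and the matrix estimate
    becomes scalar: cosines in the real part, sines plus the contribution of \<open>R\<close> in the
    imaginary part.\<close>
  have entry_E: "entry i j (E h) = entry i j (S h) - ((if i = j then exp (\<i> * complex_of_real (h * d i)) else 0)
      + \<i> * complex_of_real (h ^ (p + 1) * (P' ** R ** P) $ i $ j))" for i j h
  proof -
    have "cscale (\<i> * complex_of_real h) (cmat H) = cmat P ** diagm (\<lambda>i. \<i> * complex_of_real (h * d i)) ** cmat P'"
      by (simp add: H cmat_mult cmat_diagm cscale_def vec_eq_iff matrix_matrix_mult_def diagm_nth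
          sum_distrib_left if_distrib sum_distrib_right mult_ac cong: if_cong)
    then have "entry i j (mexp (cscale (\<i> * complex_of_real h) (cmat H)))
        = (cmat P' ** (cmat P ** diagm (\<lambda>i. exp (\<i> * complex_of_real (h * d i))) ** cmat P') ** cmat P) $ i $ j"
      by (simp add: mexp_conjugate_diagm[OF cPP' cP'P] entry_def)
    also have "cmat P' ** (cmat P ** diagm (\<lambda>i. exp (\<i> * complex_of_real (h * d i))) ** cmat P') ** cmat P
        = (cmat P' ** cmat P) ** diagm (\<lambda>i. exp (\<i> * complex_of_real (h * d i))) ** (cmat P' ** cmat P)"
      by (simp only: matrix_mul_assoc)
    finally have 1: "entry i j (mexp (cscale (\<i> * complex_of_real h) (cmat H)))
        = (if i = j then exp (\<i> * complex_of_real (h * d i)) else 0)"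
      by (simp add: cP'P diagm_nth)
    have "entry i j (cscale z (cmat R)) = z * entry i j (cmat R)" for z
      by (simp add: entry_def cscale_def matrix_matrix_mult_def sum_distrib_left sum_distrib_right mult_ac)
    moreover have "entry i j (cmat R) = complex_of_real ((P' ** R ** P) $ i $ j)"
      unfolding entry_def by (simp flip: cmat_mult)
    ultimately have 2: "entry i j (cscale (\<i> * complex_of_real h ^ (p + 1)) (cmat R))
        = \<i> * complex_of_real (h ^ (p + 1) * (P' ** R ** P) $ i $ j)" by simp
    show ?thesis unfolding E_def linear_diff[OF entry_lin] linear_add[OF entry_lin] 1 2 ..
  qed
  define X where "X h = map_matrix Re (cmat P' ** S h ** cmat P)" for h
  define Y where "Y h = map_matrix Im (cmat P' ** S h ** cmat P)" for h
  have X_nth: "X h $ i $ j = Re (entry i j (S h))" and Y_nth: "Y h $ i $ j = Im (entry i j (S h))" for h i j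
    by (simp_all add: X_def Y_def entry_def)
  have X: "smooth_on UNIV (\<lambda>h. X h $ i $ j)" for i j
    unfolding X_nth by (rule smooth_on_linear_image[OF entry_Re smooth_S])
  have Y: "smooth_on UNIV (\<lambda>h. Y h $ i $ j)" for i j
    unfolding Y_nth by (rule smooth_on_linear_image[OF entry_Im smooth_S])
  have rev: "map_matrix cnj (S h) ** S h = Finite_Cartesian_Product.mat 1" for h
    using reversible[of h] matrix_inv_right_left[of "S h"] by simp
  note comm = conjugation_parts(1)[OF PP' P'P rev, folded X_def Y_def]
  note sq = conjugation_parts(2)[OF PP' P'P rev, folded X_def Y_def]
  have smooth_scaled: "smooth_on UNIV (\<lambda>h. if i = j then f (h * d i) else 0)" if "smooth_on UNIV f"
    for f :: "real \<Rightarrow> real" and i j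
  proof -
    have "smooth_on UNIV (\<lambda>h. f (h * d i))"
      by (rule smooth_on_compose[OF that]) (auto intro: smooth_on_mult smooth_on_ident smooth_on_const)
    then show ?thesis by (cases "i = j") (simp_all add: smooth_on_const)
  qed
  \<comment> \<open>As \<open>R\<close> is real it does not enter the real part, so the coefficient
    to split off is 0. Only the value of the factorization at \<open>h = 0\<close> is used.\<close>
  have X0: "X 0 = Finite_Cartesian_Product.mat 1"
  proof -
    have "X 0 $ i $ j = (if i = j then 1 else 0)" for i j
    proof (rule smooth_divide_power[of "\<lambda>h. X h $ i $ j - (if i = j then cos (h * d i) else 0)" 0 "p + 1"])
      show "smooth_on UNIV (\<lambda>h. X h $ i $ j - (if i = j then cos (h * d i) else 0))"
        by (intro smooth_on_diff X smooth_scaled smooth_on_cos)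
      have "Re (entry i j (E h)) = X h $ i $ j - (if i = j then cos (h * d i) else 0) - 0 * h ^ (p + 1)" for h
        unfolding entry_E by (simp add: X_nth Re_exp)
      then show "(\<lambda>h. X h $ i $ j - (if i = j then cos (h * d i) else 0) - 0 * h ^ (p + 1)) \<in> O[at 0](\<lambda>h. h ^ Suc (p + 1))"
        using bounded_linear_bigo[OF entry_Re E, of i j] by simp
      fix g assume "\<And>h. X h $ i $ j - (if i = j then cos (h * d i) else 0) = h ^ (p + 1) * g h"
      from this[of 0] show ?thesis by simp
    qed
    then show ?thesis by (simp add: vec_eq_iff Finite_Cartesian_Product.mat_def)
  qed
  have "\<exists>n. smooth_on UNIV n \<and> (\<forall>h. Y h $ i $ j - (if i = j then sin (h * d i) else 0) = h ^ (p + 1) * n h)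
      \<and> n 0 = (P' ** R ** P) $ i $ j" for i j
  proof (rule smooth_divide_power[of "\<lambda>h. Y h $ i $ j - (if i = j then sin (h * d i) else 0)"
        "(P' ** R ** P) $ i $ j" "p + 1"])
    show "smooth_on UNIV (\<lambda>h. Y h $ i $ j - (if i = j then sin (h * d i) else 0))"
      by (intro smooth_on_diff Y smooth_scaled smooth_on_sin)
    have "Im (entry i j (E h)) = Y h $ i $ j - (if i = j then sin (h * d i) else 0)
        - (P' ** R ** P) $ i $ j * h ^ (p + 1)" for h
      unfolding entry_E by (simp add: Y_nth Im_exp)
    then show "(\<lambda>h. Y h $ i $ j - (if i = j then sin (h * d i) else 0) - (P' ** R ** P) $ i $ j * h ^ (p + 1))
        \<in> O[at 0](\<lambda>h. h ^ Suc (p + 1))"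
      using bounded_linear_bigo[OF entry_Im E, of i j] by simp
    fix n assume "smooth_on UNIV n"
      "\<And>h. Y h $ i $ j - (if i = j then sin (h * d i) else 0) = h ^ (p + 1) * n h"
      "n 0 = (P' ** R ** P) $ i $ j"
    then show ?thesis by blast
  qed
  then have "\<forall>i. \<forall>j. \<exists>n. smooth_on UNIV n \<and>
      (\<forall>h. Y h $ i $ j - (if i = j then sin (h * d i) else 0) = h ^ (p + 1) * n h)
      \<and> n 0 = (P' ** R ** P) $ i $ j" by blast
  then have "\<forall>i. \<exists>n. \<forall>j. smooth_on UNIV (n j) \<and>
      (\<forall>h. Y h $ i $ j - (if i = j then sin (h * d i) else 0) = h ^ (p + 1) * n j h)
      \<and> n j 0 = (P' ** R ** P) $ i $ j" by (intro allI choice) blast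
  from choice[OF this] obtain n where n: "\<forall>i j. smooth_on UNIV (n i j) \<and>
      (\<forall>h. Y h $ i $ j - (if i = j then sin (h * d i) else 0) = h ^ (p + 1) * n i j h)
      \<and> n i j 0 = (P' ** R ** P) $ i $ j" ..
  define N where "N h = (\<chi> i j. n i j h)" for h
  have N: "smooth_on UNIV (\<lambda>h. N h $ i $ j)" for i j using n by (simp add: N_def)
  have N0: "N 0 $ i $ j = (if i = j then \<mu> j else 0)" if "d i = d j" for i j
    using n R'[OF that] by (simp add: N_def)
  show ?thesis
  proof (rule smooth_sin_quotient)
    fix G :: "real \<Rightarrow> real \<Rightarrow> real"
    assume G: "\<And>t. smooth_on UNIV (G t)" "\<And>t h. sin (h * t) = h * G t h" "\<And>t. G t 0 = t"
    have Y_eq: "Y h $ i $ j = (if i = j then h * G (d i) h else 0) + h ^ (p + 1) * N h $ i $ j" for h i j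
    proof -
      have "Y h $ i $ j - (if i = j then sin (h * d i) else 0) = h ^ (p + 1) * n i j h" using n by blast
      then show ?thesis by (simp add: N_def G(2) algebra_simps)
    qed
    have X_cont: "isCont (\<lambda>h. X h $ i $ j) 0" for i j using smooth_on_imp_isCont[OF X] by simp
    show ?thesis
    proof (rule smooth_local_diagonalization[of N "\<lambda>i. G (d i)" d p \<mu> X Y])
      fix \<delta> :: real and V s c
      assume \<delta>: "\<delta> > 0" and V: "\<And>i j. smooth_on {-\<delta><..<\<delta>} (\<lambda>h. V h $ i $ j)"
        and s: "\<And>k. smooth_on {-\<delta><..<\<delta>} (s k)" and V0: "V 0 = diagm c" and c: "\<And>k::'n. c k \<noteq> 0"
        and s0: "\<And>k. s k 0 = 0"
        and local: "\<And>h. \<bar>h\<bar> < \<delta> \<Longrightarrow> invertible (V h) \<and> (\<forall>k. \<bar>s k h\<bar> < 1) \<and>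
          Y h ** V h = V h ** diagm (\<lambda>k. s k h) \<and> X h ** V h = V h ** diagm (\<lambda>k. sqrt (1 - (s k h)\<^sup>2))"
      show ?thesis
      proof (rule smooth_local_identity[OF \<delta>])
        fix \<phi> and \<eta> :: real
        assume \<phi>: "smooth_on UNIV \<phi>" "\<And>h. \<bar>\<phi> h\<bar> < \<delta>" and \<eta>: "\<eta> > 0" "\<And>h. \<bar>h\<bar> < \<eta> \<Longrightarrow> \<phi> h = h"
        have \<phi>_mem: "\<phi> h \<in> {-\<delta><..<\<delta>}" for h using \<phi>(2)[of h] by (simp add: abs_less_iff)
        \<comment> \<open>Precomposition with \<phi> makes the angle smooth on the whole line. It is
          the argument of the eigenvalue of \<open>S h\<close> for \<bar>h\<bar> < \<eta>, where the
          factorization is claimed.\<close>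
        define \<theta> where "\<theta> k h = arcsin (s k (\<phi> h))" for k h
        have \<theta>: "smooth_on UNIV (\<theta> k)" for k
        proof -
          have "s k (\<phi> h) \<in> {-1<..<1}" for h using local[OF \<phi>(2)[of h]] by (auto simp: abs_less_iff)
          then show ?thesis unfolding \<theta>_def[abs_def]
            by (intro smooth_on_compose[OF smooth_on_arcsin] smooth_on_compose[OF s \<phi>(1)] \<phi>_mem)
        qed
        have \<phi>0: "\<phi> 0 = 0" using \<eta> by simp
        \<comment> \<open>The angle vanishes at 0 because \<open>s k 0 = 0\<close>, so its quotient
          by \<open>h\<close> extends smoothly across 0.\<close>
        have "\<exists>D. smooth_on UNIV D \<and> (\<forall>h. \<theta> k h = h * D h)" for k
          by (rule hadamard[OF \<theta>[of k]]) (auto simp: \<theta>_def \<phi>0 s0)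
        then have "\<forall>k. \<exists>D. smooth_on UNIV D \<and> (\<forall>h. \<theta> k h = h * D h)" ..
        from choice[OF this] obtain Dk where Dk: "\<forall>k. smooth_on UNIV (Dk k) \<and> (\<forall>h. \<theta> k h = h * Dk k h)" ..
        define D where "D h = diagm (\<lambda>k. Dk k h)" for h
        define Ph where "Ph h = P ** V (\<phi> h)" for h
        have "smooth D"
        proof (rule smooth_matI)
          show "smooth_on UNIV (\<lambda>h. D h $ i $ j)" for i j
            using Dk by (cases "i = j") (simp_all add: D_def diagm_nth smooth_on_const)
        qed
        moreover have "diagonal (D h)" for h by (simp add: D_def diagonal_diagm)
        moreover have "smooth Ph"
        proof (rule smooth_matI)
          show "smooth_on UNIV (\<lambda>h. Ph h $ i $ j)" for i j
            unfolding Ph_def matrix_matrix_mult_def vec_lambda_beta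
            by (intro smooth_on_sum smooth_on_mult smooth_on_const smooth_on_compose[OF V \<phi>(1)] \<phi>_mem)
        qed
        moreover have Ph_inv: "invertible (Ph h)" for h
          unfolding Ph_def using inverse_matrix_unique(1)[OF PP' P'P] local[OF \<phi>(2)[of h]]
          by (intro invertible_mult) auto
        let ?C' = "diagm (\<lambda>k. inverse (c k))"
        have CC': "diagm c ** ?C' = Finite_Cartesian_Product.mat 1" "?C' ** diagm c = Finite_Cartesian_Product.mat 1"
          using c by (simp_all add: diagm_mult_diagm diagm_one)
        \<comment> \<open>The basis at 0 differs from \<open>P\<close> only by a diagonal factor,
          which preserves diagonality of conjugates.\<close>
        have Ph0: "Ph 0 = P ** diagm c" by (simp add: Ph_def \<phi>0 V0)
        have inv0: "matrix_inv (Ph 0) = ?C' ** P'"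
        proof (rule inverse_matrix_unique(2))
          have "Ph 0 ** (?C' ** P') = P ** (diagm c ** ?C') ** P'" by (simp only: Ph0 matrix_mul_assoc)
          then show "Ph 0 ** (?C' ** P') = Finite_Cartesian_Product.mat 1" by (simp add: CC' PP')
          have "?C' ** P' ** Ph 0 = ?C' ** (P' ** P) ** diagm c" by (simp only: Ph0 matrix_mul_assoc)
          then show "?C' ** P' ** Ph 0 = Finite_Cartesian_Product.mat 1" by (simp add: CC' P'P)
        qed
        have "diagonal (matrix_inv (Ph 0) ** H ** Ph 0)"
        proof -
          have "matrix_inv (Ph 0) ** H ** Ph 0 = ?C' ** (P' ** P) ** diagm d ** (P' ** P) ** diagm c"
            unfolding inv0 unfolding Ph0 H_eq by (simp only: matrix_mul_assoc)
          then show ?thesis by (simp add: P'P diagm_mult_diagm diagonal_diagm)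
        qed
        moreover have "diagonal (matrix_inv (cmat (Ph 0)) ** B ** cmat (Ph 0))"
        proof -
          let ?R = "cmat (P' ** R ** P)"
          have sum_mult: "A ** (\<Sum>x\<in>I. F x) ** A' = (\<Sum>x\<in>I. A ** F x ** A')" for A A' :: "complex^'n^'n"
            and F and I :: "complex set"
            by (induction I rule: infinite_finite_induct) (simp_all add: matrix_add_mult_distrib matrix_add_ldistrib)
          have "cmat P' ** (cmat P ** ind \<omega> ** cmat P' ** cmat R ** (cmat P ** ind \<omega> ** cmat P')) ** cmat P
              = ind \<omega> ** ?R ** ind \<omega>" for \<omega>
          proof -
            have "cmat P' ** (cmat P ** ind \<omega> ** cmat P' ** cmat R ** (cmat P ** ind \<omega> ** cmat P')) ** cmat P
              = (cmat P' ** cmat P) ** ind \<omega> ** (cmat P' ** cmat R ** cmat P) ** ind \<omega> ** (cmat P' ** cmat P)"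
              by (simp only: matrix_mul_assoc)
            then show ?thesis by (simp add: cP'P cmat_mult)
          qed
          then have B: "cmat P' ** B ** cmat P = (\<Sum>\<omega>\<in>spectrum (cmat H). ind \<omega> ** ?R ** ind \<omega>)"
            unfolding B_def sum_mult spectral_projector_eq by simp
          \<comment> \<open>A summand can be nonzero only where both indices belong to \<omega>, and
            inside that eigenspace \<open>R\<close> is diagonal by the choice of
            \<open>P\<close>.\<close>
          have "(cmat P' ** B ** cmat P) $ i $ j = 0" if "i \<noteq> j" for i j
            unfolding B sum_component
          proof (rule sum.neutral, rule ballI)
            fix \<omega>
            have "(ind \<omega> ** ?R ** ind \<omega>) $ i $ j
                = (if complex_of_real (d i) = \<omega> then 1 else 0) * complex_of_real ((P' ** R ** P) $ i $ j)
                  * (if complex_of_real (d j) = \<omega> then 1 else 0)"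
              by (simp only: ind_def mult_diagm_nth diagm_mult_nth nth_map_matrix)
            then show "(ind \<omega> ** ?R ** ind \<omega>) $ i $ j = 0" using R'[of i j] that by auto
          qed
          then obtain b where b: "cmat P' ** B ** cmat P = diagm b"
            using diagonal_imp_diagm[of "cmat P' ** B ** cmat P"] by (auto simp: diagonal_def)
          have "matrix_inv (cmat (Ph 0)) ** B ** cmat (Ph 0) = cmat ?C' ** (cmat P' ** B ** cmat P) ** cmat (diagm c)"
            unfolding matrix_inv_cmat[OF Ph_inv] inv0 unfolding Ph0 cmat_mult by (simp only: matrix_mul_assoc)
          then show ?thesis unfolding b by (simp add: cmat_diagm diagm_mult_diagm diagonal_diagm)
        qed
        moreover have "S h = cmat (Ph h) ** mexp (cscale (\<i> * complex_of_real h) (cmat (D h)))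
            ** matrix_inv (cmat (Ph h))" if h: "\<bar>h\<bar> < \<eta>" for h
        proof -
          let ?W = "diagm (\<lambda>k. exp (\<i> * complex_of_real (\<theta> k h)))"
          have "\<theta> k h = h * Dk k h" for k using Dk by blast
          then have "cscale (\<i> * complex_of_real h) (cmat (D h)) = diagm (\<lambda>k. \<i> * complex_of_real (\<theta> k h))"
            by (simp add: D_def cscale_cmat_diagm mult.assoc)
          then have W: "mexp (cscale (\<i> * complex_of_real h) (cmat (D h))) = ?W"
            using mexp_conjugate_diagm[of "Finite_Cartesian_Product.mat 1 :: complex^'n^'n"
                "Finite_Cartesian_Product.mat 1"] by simp
          have \<phi>h: "\<phi> h = h" and hd: "\<bar>h\<bar> < \<delta>" using \<eta>(2)[OF h] \<phi>(2)[of h] by simp_all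
          note loc = local[OF hd]
          \<comment> \<open>The columns of \<open>V h\<close> diagonalize both parts, with
            eigenvalues cos \<theta> and sin \<theta>; the positive root is the cosine because
            \<open>arcsin\<close> takes values between -pi/2 and pi/2.\<close>
          have SV: "(cmat P' ** S h ** cmat P) ** cmat (V h) = cmat (V h) ** ?W"
          proof -
            have Sh: "cmat P' ** S h ** cmat P = cmat (X h) + cscale \<i> (cmat (Y h))"
              by (simp add: vec_eq_iff X_def Y_def cscale_def flip: complex_eq)
            have cs: "cscale \<i> A ** A' = cscale \<i> (A ** A')" for A A' :: "complex^'n^'n"
              by (simp add: vec_eq_iff cscale_def matrix_matrix_mult_def sum_distrib_left mult.assoc)
            have "(cmat P' ** S h ** cmat P) ** cmat (V h) = cmat (X h ** V h) + cscale \<i> (cmat (Y h ** V h))"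
              unfolding Sh by (simp add: matrix_add_mult_distrib cs cmat_mult)
            also have "\<dots> = cmat (V h ** diagm (\<lambda>k. sqrt (1 - (s k h)\<^sup>2))) + cscale \<i> (cmat (V h ** diagm (\<lambda>k. s k h)))"
              using loc by simp
            also have "\<dots> = cmat (V h) ** ?W"
            proof -
              have "exp (\<i> * complex_of_real (\<theta> k h)) = complex_of_real (sqrt (1 - (s k h)\<^sup>2)) + \<i> * complex_of_real (s k h)" for k
              proof -
                have "-1 \<le> s k h" "s k h \<le> 1" using loc by (auto simp: abs_less_iff intro: less_imp_le)
                then have "cos (\<theta> k h) = sqrt (1 - (s k h)\<^sup>2)" "sin (\<theta> k h) = s k h"
                  by (simp_all add: \<theta>_def \<phi>h cos_arcsin)
                then show ?thesis by (simp add: complex_eq_iff Re_exp Im_exp)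
              qed
              then show ?thesis
                by (simp add: vec_eq_iff mult_diagm_nth cscale_def algebra_simps)
            qed
            finally show ?thesis .
          qed
          have "S h ** cmat (Ph h) = cmat P ** ((cmat P' ** S h ** cmat P) ** cmat (V h))"
          proof -
            have "cmat P ** ((cmat P' ** S h ** cmat P) ** cmat (V h)) = (cmat P ** cmat P') ** S h ** (cmat P ** cmat (V h))"
              by (simp only: matrix_mul_assoc)
            then show ?thesis by (simp add: cPP' Ph_def \<phi>h cmat_mult)
          qed
          also have "\<dots> = cmat (Ph h) ** ?W" by (simp add: SV Ph_def \<phi>h cmat_mult matrix_mul_assoc)
          finally have "S h ** (cmat (Ph h) ** matrix_inv (cmat (Ph h))) = cmat (Ph h) ** ?W ** matrix_inv (cmat (Ph h))"
            by (simp add: matrix_mul_assoc)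
          moreover have "cmat (Ph h) ** matrix_inv (cmat (Ph h)) = Finite_Cartesian_Product.mat 1"
            using matrix_inv_right_left Ph_inv invertible_cmat_iff by blast
          ultimately show ?thesis unfolding W by simp
        qed
        ultimately show ?thesis using \<eta>(1) Ph_inv by (intro exI[of _ D] exI[of _ Ph] conjI allI exI[of _ \<eta>] impI)
      qed
    qed (use N G N0 distinct order_p X_cont X0 Y_eq comm sq in simp_all)
  qed
qed

end
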